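(* Let $B\sim N(0,I_d)$ and $S_n=\sum_{i=1}^n\frac{\xi_i}{\sqrt n}$, where $(\xi_i)_{i\in\mathbb{N}}$ are i.i.d. random vectors in $\mathbb{R}^d$ with $\mathbb{E}\xi_i=0$, $\mathbb{E}\xi_i\xi_i^T=I_d$ and $\sup_i\mathbb{E}|\xi_i|^3<\infty$. Then $$d_W(\mathcal{L}(B),\mathcal{L}(S_n))\le\Big[\big(\tfrac23d+1\big)\mathbb{E}|B|+\tfrac13\mathbb{E}|\xi_1|^3+\mathbb{E}|\xi_1|\Big]n^{-1/2}(1+\ln n).$$
   Context: $d_W(\mu,\nu)=\sup\{|\mathbb{E}h(X)-\mathbb{E}h(Y)|: h:\mathbb{R}^d\to\mathbb{R},\ |h(x)-h(y)|\le|x-y|\}$ with $X\sim\mu$, $Y\sim\nu$. *)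

theory Defs
  imports "HOL-Probability.Probability"
begin

definition std_gaussian :: "(real ^ 'n) measure" where
  "std_gaussian = density lborel
     (\<lambda>x. ennreal ((2 * pi) powr (- real CARD('n) / 2) * exp (- (norm x)\<^sup>2 / 2)))"

text \<open>Wasserstein-1 distance via the dual (1-Lipschitz test function) formulation.\<close>
definition wasserstein_dist :: "(real ^ 'n) measure \<Rightarrow> (real ^ 'n) measure \<Rightarrow> ennreal" where
  "wasserstein_dist \<mu> \<nu> =
     (SUP h \<in> {h :: real ^ 'n \<Rightarrow> real. \<forall>x y. \<bar>h x - h y\<bar> \<le> dist x y}.
        ennreal \<bar>(\<integral>x. h x \<partial>\<mu>) - (\<integral>x. h x \<partial>\<nu>)\<bar>)"

end

theory Submission
  imports Defs
begin

text \<open>Lindeberg's replacement argument with Gaussian smoothing. Replace the summands \<open>\<xi>\<^sub>1, \<dots>, \<xi>\<^sub>n\<close>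
  by independent standard Gaussians one at a time. While the \<open>k\<close>-th summand is exchanged, the Gaussian summands that
  are still present smooth the test function \<open>h\<close> at scale \<open>s = sqrt ((n - k) / n)\<close>. The smoothed function has a
  second-order Taylor expansion whose remainder is cubic with constant at most \<open>1 / (6 s\<^sup>2)\<close>, because all
  derivatives but one can be moved onto the Gaussian density and \<open>E|G\<^sup>2 - 1| \<le> 1\<close> for a standard normal
  \<open>G\<close>. First and second order terms agree for the two summands, so an exchange costs
  \<open>n\<^bsup>-1/2\<^esup> (E|B|\<^sup>3 + E|\<xi>\<^sub>1|\<^sup>3) / (6 (n - k))\<close>, and the harmonic sum over
  \<open>k < n\<close> produces the logarithm. The last exchange, where nothing is left to smooth, costs
  \<open>n\<^bsup>-1/2\<^esup> (E|B| + E|\<xi>\<^sub>1|)\<close> by the Lipschitz bound.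

  In the statement, the Gaussian measure inside \<open>E|B|\<close> on the right-hand side carries a type variable of its own,
  so that its dimension is independent of \<open>d\<close>. The bound is therefore proved with \<open>E|B|\<close> replaced by the
  constant \<open>3/4\<close>, which is at most \<open>E|B|\<close> in every dimension; this uses \<open>E|B| \<le> sqrt d\<close> and
  \<open>E|\<xi>\<^sub>1|\<^sup>3 \<ge> d\<^bsup>3/2\<^esup>\<close>.\<close>

section \<open>The standard Gaussian measure and its moments\<close>

definition gauss_density :: "real ^ 'n \<Rightarrow> real" where
  "gauss_density x = (2 * pi) powr (- real CARD('n) / 2) * exp (- (norm x)\<^sup>2 / 2)"

lemma std_gaussian_density: "std_gaussian = density lborel (\<lambda>x. ennreal (gauss_density x))"
  by (simp add: std_gaussian_def gauss_density_def)

lemma borel_measurable_gauss_density [measurable]: "gauss_density \<in> borel_measurable borel"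
  unfolding gauss_density_def by measurable

lemma gauss_density_nonneg [simp]: "0 \<le> gauss_density x"
  by (simp add: gauss_density_def)

lemma sets_std_gaussian [measurable_cong, simp]: "sets std_gaussian = sets borel"
  by (simp add: std_gaussian_density)

lemma space_std_gaussian [simp]: "space std_gaussian = UNIV"
  by (simp add: std_gaussian_density)

lemma exp_norm_square_prod:
  fixes x :: "'a::euclidean_space"
  shows "exp (- (a * (norm x)\<^sup>2)) = (\<Prod>b\<in>Basis. exp (- (a * (x \<bullet> b)\<^sup>2)))"
proof -
  have "(norm x)\<^sup>2 = (\<Sum>b\<in>Basis. (x \<bullet> b)\<^sup>2)"
    unfolding power2_norm_eq_inner euclidean_inner [of x x] by (simp add: power2_eq_square)
  then show ?thesis
    by (simp add: exp_sum [symmetric] sum_negf sum_distrib_left)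
qed

text \<open>Tonelli factors the integral over the coordinates; each factor is read off from the
  normalisation of the centred normal density of variance \<open>1 / (2 * a)\<close>.\<close>

lemma nn_integral_exp_norm_square:
  assumes "0 < a"
  shows "(\<integral>\<^sup>+x. ennreal (exp (- (a * (norm (x::'a::euclidean_space))\<^sup>2))) \<partial>lborel)
           = ennreal (sqrt (pi / a) ^ DIM('a))"
proof -
  define s where "s = sqrt (1 / (2 * a))"
  have s: "0 < s" "s\<^sup>2 = 1 / (2 * a)"
    using assms by (simp_all add: s_def)
  have "exp (- (a * y\<^sup>2)) = sqrt (pi / a) * normal_density 0 s y" for y
  proof -
    have "sqrt (pi / a) = sqrt (2 * pi * s\<^sup>2)" and "(y - 0)\<^sup>2 / (2 * s\<^sup>2) = a * y\<^sup>2"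
      using assms by (simp_all add: s(2))
    then show ?thesis
      using s assms by (simp add: normal_density_def)
  qed
  then have "(\<integral>\<^sup>+y. ennreal (exp (- (a * y\<^sup>2))) \<partial>lborel)
      = (\<integral>\<^sup>+y. ennreal (sqrt (pi / a)) * ennreal (normal_density 0 s y) \<partial>lborel)"
    using assms by (simp add: ennreal_mult)
  also have "\<dots> = ennreal (sqrt (pi / a)) * (\<integral>\<^sup>+y. ennreal (normal_density 0 s y) \<partial>lborel)"
    by (rule nn_integral_cmult) simp
  also have "(\<integral>\<^sup>+y. ennreal (normal_density 0 s y) \<partial>lborel) = 1"
    using prob_space.emeasure_space_1 [OF prob_space_normal_density [OF s(1), of 0]]
    by (simp add: emeasure_density)
  finally have *: "(\<integral>\<^sup>+y. ennreal (exp (- (a * y\<^sup>2))) \<partial>lborel) = ennreal (sqrt (pi / a))"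
    by simp
  have "(\<integral>\<^sup>+x. ennreal (exp (- (a * (norm (x::'a))\<^sup>2))) \<partial>lborel)
      = (\<integral>\<^sup>+(x::'a). (\<Prod>b\<in>Basis. ennreal (exp (- (a * (x \<bullet> b)\<^sup>2)))) \<partial>lborel)"
    by (simp add: exp_norm_square_prod prod_ennreal)
  also have "\<dots> = (\<Prod>b\<in>(Basis::'a set). (\<integral>\<^sup>+y. ennreal (exp (- (a * y\<^sup>2))) \<partial>lborel))"
    by (rule nn_integral_lborel_prod) simp_all
  finally show ?thesis
    using assms by (simp add: * ennreal_power)
qed

lemma nn_integral_gauss_density: "(\<integral>\<^sup>+x. ennreal (gauss_density (x::real^'n)) \<partial>lborel) = 1"
proof -
  let ?c = "(2 * pi) powr (- real CARD('n) / 2)"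
  have "?c * sqrt (2 * pi) ^ CARD('n) = ?c * (2 * pi) powr (real CARD('n) / 2)"
    by (simp add: powr_half_sqrt [symmetric] powr_power mult.commute)
  also have "\<dots> = 1"
    by (simp add: powr_add [symmetric])
  finally have c: "?c * sqrt (2 * pi) ^ CARD('n) = 1" .
  have "(\<integral>\<^sup>+x. ennreal (gauss_density (x::real^'n)) \<partial>lborel)
      = (\<integral>\<^sup>+x. ennreal ?c * ennreal (exp (- (1/2 * (norm (x::real^'n))\<^sup>2))) \<partial>lborel)"
    by (simp add: gauss_density_def ennreal_mult)
  also have "\<dots> = ennreal ?c * (\<integral>\<^sup>+x. ennreal (exp (- (1/2 * (norm (x::real^'n))\<^sup>2))) \<partial>lborel)"
    by (rule nn_integral_cmult) measurable
  also have "\<dots> = ennreal (?c * sqrt (2 * pi) ^ CARD('n))"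
    by (subst nn_integral_exp_norm_square) (simp_all add: ennreal_mult mult.commute)
  finally show ?thesis
    using c by simp
qed

lemma prob_space_std_gaussian: "prob_space (std_gaussian :: (real^'n) measure)"
  by (rule prob_spaceI) (simp add: std_gaussian_density emeasure_density nn_integral_gauss_density)

lemma power_le_fact_exp: "0 \<le> t \<Longrightarrow> t ^ k \<le> fact k * exp (t::real)"
proof -
  assume t: "0 \<le> t"
  have "(\<Sum>i\<in>{k}. inverse (fact i) * t ^ i) \<le> (\<Sum>i. inverse (fact i) * t ^ i)"
    using t by (intro sum_le_suminf summable_exp) auto
  then show ?thesis
    by (simp add: exp_def field_simps)
qed

text \<open>Half of the Gaussian decay pays for the polynomial: \<open>(1 + t) ^ k\<close> is at
  most \<open>fact k * exp (1 + t)\<close>, and completing a square absorbs the linear exponent into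
  half of the quadratic one.\<close>

lemma integrable_one_plus_norm_power_exp:
  assumes "0 < a"
  shows "integrable lborel (\<lambda>x::'a::euclidean_space. (1 + norm x) ^ k * exp (- (a * (norm x)\<^sup>2)))"
proof (rule Bochner_Integration.integrable_bound)
  let ?C = "fact k * exp (1 + 1 / (2 * a))"
  show "integrable lborel (\<lambda>x::'a. ?C * exp (- (a / 2 * (norm x)\<^sup>2)))"
    using assms nn_integral_exp_norm_square [where 'a='a, of "a/2"]
    by (intro integrable_mult_right) (simp add: integrable_iff_bounded)
  have "(1 + t) ^ k * exp (- (a * t\<^sup>2)) \<le> ?C * exp (- (a / 2 * t\<^sup>2))" if t: "0 \<le> t" for t
  proof -
    have "0 \<le> (a * t - 1)\<^sup>2 / (2 * a)"
      using assms by simp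
    then have "t \<le> 1 / (2 * a) + a / 2 * t\<^sup>2"
      using assms by (simp add: power2_eq_square field_simps)
    then have le: "exp (1 + t - a * t\<^sup>2) \<le> exp (1 + 1 / (2 * a) - a / 2 * t\<^sup>2)"
      by simp
    have "(1 + t) ^ k * exp (- (a * t\<^sup>2)) \<le> (fact k * exp (1 + t)) * exp (- (a * t\<^sup>2))"
      using t by (intro mult_right_mono power_le_fact_exp) simp_all
    also have "\<dots> = fact k * exp (1 + t - a * t\<^sup>2)"
      by (simp add: exp_add [symmetric] mult.assoc)
    also have "\<dots> \<le> fact k * exp (1 + 1 / (2 * a) - a / 2 * t\<^sup>2)"
      by (intro mult_left_mono le) simp
    also have "\<dots> = ?C * exp (- (a / 2 * t\<^sup>2))"
      by (simp add: exp_add [symmetric] mult.assoc)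
    finally show ?thesis .
  qed
  then show "AE x in lborel. norm ((1 + norm (x::'a)) ^ k * exp (- (a * (norm x)\<^sup>2)))
      \<le> norm (?C * exp (- (a / 2 * (norm x)\<^sup>2)))"
    by (auto simp: abs_mult)
qed measurable

lemma integrable_norm_power_exp:
  assumes "0 < a"
  shows "integrable lborel (\<lambda>x::'a::euclidean_space. norm x ^ k * exp (- (a * (norm x)\<^sup>2)))"
  by (rule Bochner_Integration.integrable_bound [OF integrable_one_plus_norm_power_exp [OF assms, of k]])
    (auto simp: abs_mult intro!: mult_right_mono power_mono)

lemma integrable_std_gaussian_iff:
  fixes f :: "real^'n \<Rightarrow> real"
  assumes [measurable]: "f \<in> borel_measurable borel"
  shows "integrable std_gaussian f \<longleftrightarrow> integrable lborel (\<lambda>x. gauss_density x * f x)"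
  by (simp add: std_gaussian_density integrable_density)

lemma integral_std_gaussian:
  fixes f :: "real^'n \<Rightarrow> real"
  assumes [measurable]: "f \<in> borel_measurable borel"
  shows "integral\<^sup>L std_gaussian f = (\<integral>x. gauss_density x * f x \<partial>lborel)"
  by (simp add: std_gaussian_density integral_density)

lemma integrable_std_gaussian_polynomial_growth:
  fixes f :: "real^'n \<Rightarrow> real"
  assumes [measurable]: "f \<in> borel_measurable borel" and le: "\<And>x. \<bar>f x\<bar> \<le> C * (1 + norm x) ^ k"
  shows "integrable std_gaussian f"
proof (rule Bochner_Integration.integrable_bound)
  have "integrable lborel (\<lambda>x::real^'n. (2 * pi) powr (- real CARD('n) / 2)
      * (C * ((1 + norm x) ^ k * exp (- (1/2 * (norm x)\<^sup>2)))))"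
    by (intro integrable_mult_right integrable_one_plus_norm_power_exp) simp
  then show "integrable std_gaussian (\<lambda>x::real^'n. C * (1 + norm x) ^ k)"
    by (subst integrable_std_gaussian_iff) (simp_all add: gauss_density_def mult_ac)
  show "AE x in std_gaussian. norm (f x) \<le> norm (C * (1 + norm x) ^ k)"
    using order_trans [OF le abs_ge_self] by (intro AE_I2) simp
qed measurable

lemma integral_lborel_scale:
  fixes f :: "'a::euclidean_space \<Rightarrow> real"
  assumes [measurable]: "f \<in> borel_measurable borel" and c: "0 < c"
  shows "integral\<^sup>L lborel f = c ^ DIM('a) * (\<integral>x. f (c *\<^sub>R x) \<partial>lborel)"
proof -
  have "integral\<^sup>L lborel f
      = integral\<^sup>L (density (distr lborel borel (\<lambda>x::'a. 0 + c *\<^sub>R x)) (\<lambda>_. ennreal (\<bar>c\<bar> ^ DIM('a)))) f"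
    using c by (subst lborel_affine [of c 0, symmetric]) simp_all
  also have "\<dots> = c ^ DIM('a) * (\<integral>x. f (c *\<^sub>R x) \<partial>lborel)"
    using c by (subst integral_density) (simp_all add: integral_distr)
  finally show ?thesis .
qed

text \<open>Compare the integrals of \<open>|x| exp (-\<lambda> |x|\<^sup>2 / 2)\<close>, which scale like a power of \<open>\<lambda>\<close>, at
  \<open>\<lambda> = 1\<close> and \<open>\<lambda> = s\<^sup>2\<close>, and let \<open>s\<close> tend to 1.\<close>

lemma std_gaussian_third_moment_le:
  "(\<integral>x. norm (x::real^'n) ^ 3 \<partial>std_gaussian)
    \<le> (real CARD('n) + 1) * (\<integral>x. norm (x::real^'n) \<partial>std_gaussian)"
proof -
  let ?d = "CARD('n)"
  define E where "E l x = exp (- (l / 2 * (norm (x::real^'n))\<^sup>2))" for l x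
  define I J where "I = (\<integral>x. norm x * E 1 x \<partial>lborel)"
    and "J = (\<integral>x. norm x ^ 3 * E 1 x \<partial>lborel)"
  have Em [measurable]: "E l \<in> borel_measurable borel" for l
    unfolding E_def by measurable
  have int: "integrable lborel (\<lambda>x. norm x ^ k * E l x)" if "0 < l" for k l
    unfolding E_def using that by (intro integrable_norm_power_exp) simp
  have E_scale: "E 1 (s *\<^sub>R x) = E (s\<^sup>2) x" if "0 < s" for s x
    using that by (simp add: E_def power_mult_distrib)
  have scale: "(\<integral>x. norm x ^ k * E 1 x \<partial>lborel) = s ^ (?d + k) * (\<integral>x. norm x ^ k * E (s\<^sup>2) x \<partial>lborel)"
    if "0 < s" for s k
    using that by (subst integral_lborel_scale [where c = s])
      (simp_all add: E_scale power_mult_distrib power_add mult_ac)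
  \<comment> \<open>For \<open>s > 1\<close> this is the comparison of the two integrals with the
    common factor \<open>s - 1\<close> divided out, so that it stays informative as \<open>s\<close>
    tends to 1.\<close>
  have key: "(s + 1) * J \<le> 2 * s\<^sup>2 * (\<Sum>i<?d + 1. s ^ i) * I" if s: "1 < s" for s
  proof -
    have pointwise: "(s\<^sup>2 - 1) / 2 * (norm x ^ 3 * E (s\<^sup>2) x) \<le> norm x ^ 1 * E 1 x - norm x ^ 1 * E (s\<^sup>2) x"
      for x :: "real^'n"
    proof -
      let ?u = "(s\<^sup>2 - 1) / 2 * (norm x)\<^sup>2"
      \<comment> \<open>Bounding \<open>exp ?u\<close> below by \<open>1 + ?u\<close> produces the
        extra squared norm: a difference of two first-moment integrands dominates a third-moment
        integrand.\<close>
      have "E 1 x = E (s\<^sup>2) x * exp ?u"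
        by (simp add: E_def exp_add [symmetric] field_simps)
      then have "E (s\<^sup>2) x * ?u \<le> E 1 x - E (s\<^sup>2) x"
        using exp_ge_add_one_self [of ?u] mult_left_mono [of "1 + ?u" "exp ?u" "E (s\<^sup>2) x"]
        by (simp add: E_def algebra_simps)
      from mult_left_mono [OF this norm_ge_zero [of x]] show ?thesis
        by (simp add: algebra_simps power3_eq_cube power2_eq_square)
    qed
    have s0: "0 < s" "0 < s\<^sup>2" using s by simp_all
    have "(s\<^sup>2 - 1) / 2 * (\<integral>x. norm x ^ 3 * E (s\<^sup>2) x \<partial>lborel)
        = (\<integral>x. (s\<^sup>2 - 1) / 2 * (norm x ^ 3 * E (s\<^sup>2) x) \<partial>lborel)"
      by simp
    also have "\<dots> \<le> (\<integral>x. norm x ^ 1 * E 1 x - norm x ^ 1 * E (s\<^sup>2) x \<partial>lborel)"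
      by (intro integral_mono pointwise Bochner_Integration.integrable_diff integrable_mult_right int s0) simp
    also have "\<dots> = (\<integral>x. norm x ^ 1 * E 1 x \<partial>lborel) - (\<integral>x. norm x ^ 1 * E (s\<^sup>2) x \<partial>lborel)"
      by (intro Bochner_Integration.integral_diff int s0) simp
    finally have "(s\<^sup>2 - 1) / 2 * (J / s ^ (?d + 3)) \<le> I - I / s ^ (?d + 1)"
      using scale [OF s0(1), of 3] scale [OF s0(1), of 1] s0 by (simp add: I_def J_def)
    then have *: "(s\<^sup>2 - 1) / 2 * (J / s ^ (?d + 3)) * (2 * s ^ (?d + 3)) \<le> (I - I / s ^ (?d + 1)) * (2 * s ^ (?d + 3))"
      using s0 by (intro mult_right_mono) auto
    have "(s\<^sup>2 - 1) * J \<le> 2 * s\<^sup>2 * (s ^ (?d + 1) - 1) * I"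
    proof -
      have "s ^ (?d + 3) = s\<^sup>2 * s ^ (?d + 1)"
        by (simp add: power_add power3_eq_cube power2_eq_square)
      then have "(I - I / s ^ (?d + 1)) * (2 * s ^ (?d + 3)) = 2 * s\<^sup>2 * (s ^ (?d + 1) - 1) * I"
        using s0 by (simp add: left_diff_distrib right_diff_distrib del: power_Suc)
      moreover have "(s\<^sup>2 - 1) / 2 * (J / s ^ (?d + 3)) * (2 * s ^ (?d + 3)) = (s\<^sup>2 - 1) * J"
        using s0 by simp
      ultimately show ?thesis
        using * by (simp only:)
    qed
    also have "s ^ (?d + 1) - 1 = (s - 1) * (\<Sum>i<?d + 1. s ^ i)"
      by (rule power_diff_1_eq)
    finally have "(s - 1) * ((s + 1) * J) \<le> (s - 1) * (2 * s\<^sup>2 * (\<Sum>i<?d + 1. s ^ i) * I)"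
      by (simp only: power2_eq_square) (simp add: algebra_simps)
    then show ?thesis
      using s by (simp only: mult_le_cancel_left_pos)
  qed
  have 1: "((\<lambda>s. (s + 1) * J) \<longlongrightarrow> (1 + 1) * J) (at_right 1)"
    by (intro tendsto_intros)
  \<comment> \<open>In the limit the geometric sum consists of \<open>?d + 1\<close> ones, which is
    where the dimension plus one comes from.\<close>
  have 2: "((\<lambda>s. 2 * s\<^sup>2 * (\<Sum>i<?d + 1. s ^ i) * I) \<longlongrightarrow> 2 * 1\<^sup>2 * (\<Sum>i<?d + 1. 1 ^ i) * I) (at_right 1)"
    by (intro tendsto_intros)
  have "\<forall>\<^sub>F s in at_right 1. (s + 1) * J \<le> 2 * s\<^sup>2 * (\<Sum>i<?d + 1. s ^ i) * I"
    using eventually_at_right_less [of 1] by eventually_elim (rule key)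
  then have "(1 + 1) * J \<le> 2 * 1\<^sup>2 * (\<Sum>i<?d + 1. 1 ^ i) * I"
    by (rule tendsto_le [OF _ 2 1, rotated]) simp
  then have "J \<le> (real ?d + 1) * I" by (simp add: algebra_simps)
  then have "(2 * pi) powr (- real ?d / 2) * J \<le> (2 * pi) powr (- real ?d / 2) * ((real ?d + 1) * I)"
    by (intro mult_left_mono) auto
  moreover have "(\<integral>x. norm (x::real^'n) ^ k \<partial>std_gaussian)
      = (2 * pi) powr (- real ?d / 2) * (\<integral>x. norm x ^ k * E 1 x \<partial>lborel)" for k
    by (simp add: integral_std_gaussian gauss_density_def E_def mult_ac flip: integral_mult_right_zero)
  from this [of 3] this [of 1] have "(\<integral>x. norm (x::real^'n) ^ 3 \<partial>std_gaussian) = (2 * pi) powr (- real ?d / 2) * J"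
    "(\<integral>x. norm (x::real^'n) \<partial>std_gaussian) = (2 * pi) powr (- real ?d / 2) * I"
    by (simp_all add: I_def J_def)
  ultimately show ?thesis
    by (simp add: mult.left_commute)
qed

section \<open>Translation, product integrability and pointwise bounds\<close>

lemma integral_lborel_translate:
  fixes f :: "'a::euclidean_space \<Rightarrow> real"
  assumes [measurable]: "f \<in> borel_measurable borel"
  shows "(\<integral>x. f (x + w) \<partial>lborel) = integral\<^sup>L lborel f"
    and "integrable lborel (\<lambda>x. f (x + w)) \<longleftrightarrow> integrable lborel f"
proof -
  have "integral\<^sup>L (distr lborel borel ((+) w)) f = (\<integral>x. f (x + w) \<partial>lborel)"
    "integrable (distr lborel borel ((+) w)) f \<longleftrightarrow> integrable lborel (\<lambda>x. f (x + w))"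
    by (simp_all add: integral_distr integrable_distr_eq add.commute)
  then show "(\<integral>x. f (x + w) \<partial>lborel) = integral\<^sup>L lborel f"
    and "integrable lborel (\<lambda>x. f (x + w)) \<longleftrightarrow> integrable lborel f"
    by (simp_all add: lborel_distr_plus)
qed

text \<open>A dominating function in product form makes both iterated integrals finite at once. This
  licenses Fubini for the Taylor remainder, an integral over time and space.\<close>

lemma (in pair_sigma_finite) integrable_product_bound:
  fixes f :: "'a \<times> 'b \<Rightarrow> real"
  assumes f [measurable]: "f \<in> borel_measurable (M1 \<Otimes>\<^sub>M M2)"
    and a: "integrable M1 a" and b: "integrable M2 b"
    and le: "\<And>x y. \<bar>f (x, y)\<bar> \<le> a x * b y"
  shows "integrable (M1 \<Otimes>\<^sub>M M2) f"
proof (rule Fubini_integrable)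
  have int: "integrable M2 (\<lambda>y. f (x, y))" if "x \<in> space M1" for x
    using that by (intro Bochner_Integration.integrable_bound [OF integrable_mult_right [OF b, of "a x"]])
      (auto intro!: AE_I2 order_trans [OF le abs_ge_self])
  then show "AE x in M1. integrable M2 (\<lambda>y. f (x, y))"
    by (intro AE_I2)
  show "integrable M1 (\<lambda>x. \<integral>y. norm (f (x, y)) \<partial>M2)"
  proof (rule Bochner_Integration.integrable_bound [OF integrable_mult_left [OF a, of "integral\<^sup>L M2 b"]])
    have "\<bar>\<integral>y. norm (f (x, y)) \<partial>M2\<bar> \<le> \<bar>a x * integral\<^sup>L M2 b\<bar>" if "x \<in> space M1" for x
    proof -
      have "(\<integral>y. norm (f (x, y)) \<partial>M2) \<le> (\<integral>y. a x * b y \<partial>M2)"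
        using int [OF that] b le by (intro integral_mono) auto
      moreover have "0 \<le> (\<integral>y. norm (f (x, y)) \<partial>M2)"
        by simp
      ultimately show ?thesis
        by simp
    qed
    then show "AE x in M1. norm (\<integral>y. norm (f (x, y)) \<partial>M2) \<le> norm (a x * integral\<^sup>L M2 b)"
      by (intro AE_I2) simp
  qed measurable
qed measurable

lemma lipschitz_borel_measurable:
  fixes h :: "'a::euclidean_space \<Rightarrow> real"
  assumes "\<And>x y. \<bar>h x - h y\<bar> \<le> K * dist x y"
  shows "h \<in> borel_measurable borel"
proof (rule borel_measurable_continuous_onI)
  \<comment> \<open>Two distinct points, the origin and a basis vector, force the Lipschitz constant
    to be nonnegative.\<close>
  have "0 \<le> K"
    using order_trans [OF abs_ge_zero assms [of 0 "SOME b. b \<in> Basis"]] nonempty_Basis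
    by (auto simp: zero_le_mult_iff some_in_eq dest: nonzero_Basis)
  then have "K-lipschitz_on UNIV h"
    using assms by (auto simp: lipschitz_on_def dist_real_def)
  then show "continuous_on UNIV h"
    by (rule lipschitz_on_continuous_on)
qed

text \<open>A domination uniform in \<open>t\<close>: the squared norm of \<open>y\<close> is at
  most twice that of \<open>y - t *\<^sub>R w\<close> plus twice that of \<open>w\<close>, so half
  of the decay in \<open>y\<close> survives every shift.\<close>

lemma gauss_density_le:
  fixes y w :: "real^'n"
  assumes "0 \<le> t" "t \<le> 1"
  shows "gauss_density (y - t *\<^sub>R w)
      \<le> (2 * pi) powr (- real CARD('n) / 2) * exp ((norm w)\<^sup>2 / 2) * exp (- (1/4 * (norm y)\<^sup>2))"
proof -
  have "norm y \<le> norm (y - t *\<^sub>R w) + norm w"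
    using norm_triangle_ineq [of "y - t *\<^sub>R w" "t *\<^sub>R w"] assms mult_right_mono [of t 1 "norm w"]
    by simp
  then have "(norm y)\<^sup>2 \<le> (norm (y - t *\<^sub>R w) + norm w)\<^sup>2"
    by (intro power_mono) auto
  also have "\<dots> \<le> 2 * (norm (y - t *\<^sub>R w))\<^sup>2 + 2 * (norm w)\<^sup>2"
    using sum_squares_bound [of "norm (y - t *\<^sub>R w)" "norm w"] by (simp add: power2_sum)
  finally have "- (norm (y - t *\<^sub>R w))\<^sup>2 / 2 \<le> (norm w)\<^sup>2 / 2 + - (1/4 * (norm y)\<^sup>2)"
    by simp
  then show ?thesis
    unfolding gauss_density_def mult.assoc exp_add [symmetric] by (intro mult_left_mono) simp_all
qed

section \<open>Second-order expansion of Gaussian averages\<close>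

text \<open>Here \<open>g\<close> is the second derivative of the density along the line from
  \<open>y\<close> to \<open>y - w\<close>. This is Taylor's formula with integral remainder, with
  the second-order term split off because \<open>1 - t\<close> has integral 1/2 over the unit
  interval.\<close>

lemma gauss_density_taylor:
  fixes y w :: "real^'n"
  defines "g \<equiv> \<lambda>t. (((y - t *\<^sub>R w) \<bullet> w)\<^sup>2 - (norm w)\<^sup>2) * gauss_density (y - t *\<^sub>R w)"
  shows "(\<integral>t. (1 - t) * (g t - g 0) * indicator {0..1} t \<partial>lborel)
    = gauss_density (y - w) - gauss_density y - gauss_density y * (y \<bullet> w)
      - 1/2 * (gauss_density y * ((y \<bullet> w)\<^sup>2 - (norm w)\<^sup>2))"
proof -
  define p where "p t = gauss_density (y - t *\<^sub>R w)" for t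
  have p_eq: "p t = (2 * pi) powr (- real CARD('n) / 2)
      * exp (t * (y \<bullet> w) - t\<^sup>2 * ((norm w)\<^sup>2 / 2) - (norm y)\<^sup>2 / 2)" for t
    unfolding p_def gauss_density_def power2_norm_eq_inner
    by (simp add: inner_diff_left inner_diff_right inner_commute power2_eq_square field_simps)
  define l where "l t = (y - t *\<^sub>R w) \<bullet> w" for t
  have l_eq: "l t = y \<bullet> w - t * (norm w)\<^sup>2" for t
    by (simp add: l_def inner_diff_left power2_norm_eq_inner)
  have dp: "(p has_real_derivative l t * p t) (at t)" for t
    unfolding p_eq [abs_def] l_eq
    by (rule derivative_eq_intros refl | simp)+
  have dl: "(l has_real_derivative - (norm w)\<^sup>2) (at t)" for t
    unfolding l_eq [abs_def] by (auto intro!: derivative_eq_intros)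
  have g: "g t = ((l t)\<^sup>2 - (norm w)\<^sup>2) * p t" for t
    by (simp add: g_def l_def p_def)
  \<comment> \<open>A primitive of the integrand: the first two terms come from integrating
    \<open>(1 - t)\<close> times the second derivative of \<open>p\<close> by parts, the last one
    from the constant \<open>g 0\<close>.\<close>
  define F where "F t = (1 - t) * (l t * p t) + p t + (1 - t)\<^sup>2 / 2 * g 0" for t
  have "(F has_real_derivative (1 - t) * (g t - g 0)) (at t)" for t
    unfolding F_def [abs_def] g [of t]
    by (rule derivative_eq_intros dp dl refl | simp)+ (simp add: field_simps power2_eq_square)
  moreover have "isCont (\<lambda>t. (1 - t) * (g t - g 0)) t" for t
    using DERIV_isCont [OF dp] DERIV_isCont [OF dl] unfolding g
    by (intro continuous_intros)
  ultimately have "(\<integral>t. (1 - t) * (g t - g 0) * indicator {0..1} t \<partial>lborel) = F 1 - F 0"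
    by (intro integral_FTC_Icc_real) auto
  also have "\<dots> = gauss_density (y - w) - gauss_density y - gauss_density y * (y \<bullet> w)
      - 1/2 * (gauss_density y * ((y \<bullet> w)\<^sup>2 - (norm w)\<^sup>2))"
    by (simp add: F_def g_def p_def l_def algebra_simps)
  finally show ?thesis .
qed

lemma lipschitz_linear_growth:
  fixes h :: "'a::real_normed_vector \<Rightarrow> real"
  assumes "\<And>x y. \<bar>h x - h y\<bar> \<le> K * dist x y" "0 \<le> K"
  shows "\<bar>h x\<bar> \<le> (\<bar>h 0\<bar> + K) * (1 + norm x)"
proof -
  have "\<bar>h x\<bar> \<le> \<bar>h 0\<bar> + K * norm x"
    using assms(1) [of x 0] by simp
  also have "\<dots> \<le> (\<bar>h 0\<bar> + K) * (1 + norm x)"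
    using assms(2) by (simp add: algebra_simps)
  finally show ?thesis .
qed

text \<open>The remainder is \<open>\<integral>\<^sub>0\<^sup>1 (1 - t) (F''(t) - F''(0)) dt\<close> for \<open>F(t) = E h(B + t w)\<close>. All derivatives fall on the
  Gaussian density; shifting \<open>t w\<close> back to \<open>h\<close> shows that \<open>F''\<close> is Lipschitz.\<close>

lemma std_gaussian_taylor:
  fixes h :: "real^'n \<Rightarrow> real" and w :: "real^'n"
  assumes lip: "\<And>x y. \<bar>h x - h y\<bar> \<le> K * dist x y" and K: "0 \<le> K"
  shows "\<bar>(\<integral>y. h (y + w) \<partial>std_gaussian) - (\<integral>y. h y \<partial>std_gaussian)
      - (\<integral>y. h y * (y \<bullet> w) \<partial>std_gaussian)
      - 1/2 * (\<integral>y. h y * ((y \<bullet> w)\<^sup>2 - (norm w)\<^sup>2) \<partial>std_gaussian)\<bar>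
    \<le> K * norm w / 6 * (\<integral>y. \<bar>(y \<bullet> w)\<^sup>2 - (norm w)\<^sup>2\<bar> \<partial>std_gaussian)"
proof -
  note hm [measurable] = lipschitz_borel_measurable [OF lip]
  define q where "q y = (y \<bullet> w)\<^sup>2 - (norm w)\<^sup>2" for y
  define A where "A = \<bar>h 0\<bar> + K"
  define W where "W = 1 + norm w"
  have A: "0 \<le> A" and W: "1 \<le> W" "0 \<le> W"
    using K by (simp_all add: A_def W_def)
  have qm [measurable]: "q \<in> borel_measurable borel"
    unfolding q_def by measurable
  have h_le: "\<bar>h y\<bar> \<le> A * (1 + norm y)" for y
    unfolding A_def by (rule lipschitz_linear_growth [OF lip K])
  have shift_le: "1 + norm (y + s *\<^sub>R w) \<le> W * (1 + norm y)" if "\<bar>s\<bar> \<le> 1" for s y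
  proof -
    have "norm (y + s *\<^sub>R w) \<le> norm y + norm w"
      using norm_triangle_ineq [of y "s *\<^sub>R w"] mult_right_mono [OF that, of "norm w"] by simp
    also have "1 + \<dots> \<le> W * (1 + norm y)"
      by (simp add: W_def algebra_simps)
    finally show ?thesis by simp
  qed
  have q_le: "\<bar>q y\<bar> \<le> W\<^sup>2 * (1 + norm y)\<^sup>2" for y
  proof -
    have "(y \<bullet> w)\<^sup>2 \<le> (norm y)\<^sup>2 * (norm w)\<^sup>2"
      using Cauchy_Schwarz_ineq [of y w] by (simp add: power2_norm_eq_inner)
    then have "\<bar>q y\<bar> \<le> (norm y)\<^sup>2 * (norm w)\<^sup>2 + (norm w)\<^sup>2"
      unfolding q_def by (smt (verit) zero_le_power2)
    also have "\<dots> = (norm w)\<^sup>2 * (1 + (norm y)\<^sup>2)"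
      by (simp add: algebra_simps)
    also have "\<dots> \<le> W\<^sup>2 * (1 + norm y)\<^sup>2"
      by (intro mult_mono power_mono) (auto simp: W_def power2_sum)
    finally show ?thesis .
  qed
  have int0: "integrable std_gaussian (\<lambda>y. h (y + s *\<^sub>R w))" if s: "\<bar>s\<bar> \<le> 1" for s
  proof (rule integrable_std_gaussian_polynomial_growth [where k = 1])
    fix y
    have "\<bar>h (y + s *\<^sub>R w)\<bar> \<le> A * (W * (1 + norm y))"
      using mult_left_mono [OF shift_le [OF s] A] by (rule order_trans [OF h_le])
    then show "\<bar>h (y + s *\<^sub>R w)\<bar> \<le> (A * W) * (1 + norm y) ^ 1"
      by (simp add: mult.assoc)
  qed measurable
  have int2: "integrable std_gaussian (\<lambda>y. h (y + s *\<^sub>R w) * q y)" if s: "\<bar>s\<bar> \<le> 1" for s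
  proof (rule integrable_std_gaussian_polynomial_growth [where k = 3])
    fix y
    have "\<bar>h (y + s *\<^sub>R w)\<bar> \<le> A * (W * (1 + norm y))"
      using mult_left_mono [OF shift_le [OF s] A] by (rule order_trans [OF h_le])
    then have "\<bar>h (y + s *\<^sub>R w) * q y\<bar> \<le> A * (W * (1 + norm y)) * (W\<^sup>2 * (1 + norm y)\<^sup>2)"
      using A W unfolding abs_mult by (intro mult_mono q_le) auto
    then show "\<bar>h (y + s *\<^sub>R w) * q y\<bar> \<le> (A * W ^ 3) * (1 + norm y) ^ 3"
      by (simp add: power2_eq_square power3_eq_cube mult_ac)
  qed measurable
  have int1: "integrable std_gaussian (\<lambda>y. h y * (y \<bullet> w))"
  proof (rule integrable_std_gaussian_polynomial_growth [where k = 2])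
    fix y
    have "\<bar>y \<bullet> w\<bar> \<le> W * (1 + norm y)"
      using Cauchy_Schwarz_ineq2 [of y w] by (simp add: W_def algebra_simps) (smt (verit) norm_ge_zero)
    then have "\<bar>h y * (y \<bullet> w)\<bar> \<le> A * (1 + norm y) * (W * (1 + norm y))"
      using A unfolding abs_mult by (intro mult_mono h_le) auto
    then show "\<bar>h y * (y \<bullet> w)\<bar> \<le> (A * W) * (1 + norm y)\<^sup>2"
      by (simp add: power2_eq_square mult_ac)
  qed measurable
  have intq: "integrable std_gaussian (\<lambda>y. \<bar>q y\<bar>)"
    by (rule integrable_std_gaussian_polynomial_growth [where k = 2]) (use q_le in auto)
  \<comment> \<open>\<open>P t y\<close> is the integrand of the density's Taylor remainder, tested
    against \<open>h\<close>. Integrating over \<open>t\<close> first gives the quantity to be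
    bounded; integrating over \<open>y\<close> first makes the bound visible.\<close>
  define g where "g y t = q (y - t *\<^sub>R w) * gauss_density (y - t *\<^sub>R w)" for y t
  define P where "P t y = h y * ((1 - t) * (g y t - g y 0) * indicator {0..1} t)" for t y
  have Pm [measurable]: "(\<lambda>(t, y). P t y) \<in> borel_measurable (lborel \<Otimes>\<^sub>M lborel)"
    unfolding P_def g_def by measurable
  define c where "c = (2 * pi) powr (- real CARD('n) / 2) * exp ((norm w)\<^sup>2 / 2)"
  \<comment> \<open>One factor \<open>1 + norm y\<close> comes from \<open>h\<close> and two from
    \<open>q\<close>; \<open>W ^ 4\<close> comes from \<open>q\<close> and the shift in its
    argument, and the 2 from the difference of two values of \<open>g\<close>.\<close>
  define D where "D y = 2 * A * W ^ 4 * c * ((1 + norm y) ^ 3 * exp (- (1/4 * (norm y)\<^sup>2)))" for y :: "real^'n"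
  have g_le: "\<bar>g y t\<bar> \<le> W ^ 4 * (1 + norm y)\<^sup>2 * (c * exp (- (1/4 * (norm y)\<^sup>2)))"
    if t: "0 \<le> t" "t \<le> 1" for y t
  proof -
    have "1 + norm (y - t *\<^sub>R w) \<le> W * (1 + norm y)"
      using shift_le [of "- t" y] t by simp
    then have "(1 + norm (y - t *\<^sub>R w))\<^sup>2 \<le> (W * (1 + norm y))\<^sup>2"
      by (intro power_mono) auto
    then have "W\<^sup>2 * (1 + norm (y - t *\<^sub>R w))\<^sup>2 \<le> W\<^sup>2 * (W * (1 + norm y))\<^sup>2"
      by (intro mult_left_mono) auto
    with q_le have "\<bar>q (y - t *\<^sub>R w)\<bar> \<le> W\<^sup>2 * (W * (1 + norm y))\<^sup>2"
      by (rule order_trans)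
    also have "\<dots> = W ^ 4 * (1 + norm y)\<^sup>2"
      by (simp add: power_mult_distrib power4_eq_xxxx power2_eq_square mult_ac)
    finally show ?thesis
      using gauss_density_le [OF t, of y w] unfolding g_def abs_mult c_def
      by (intro mult_mono) auto
  qed
  have P_le: "\<bar>P t y\<bar> \<le> indicator {0..1} t * D y" for t y
  proof (cases "t \<in> {0..1}")
    case True
    then have t: "0 \<le> t" "t \<le> 1" by auto
    let ?G = "W ^ 4 * (1 + norm y)\<^sup>2 * (c * exp (- (1/4 * (norm y)\<^sup>2)))"
    have "\<bar>g y t - g y 0\<bar> \<le> 2 * ?G"
      using g_le [OF t, of y] g_le [of 0 y] by simp
    then have *: "\<bar>1 - t\<bar> * \<bar>g y t - g y 0\<bar> \<le> 1 * (2 * ?G)"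
      using t by (intro mult_mono) auto
    have "\<bar>h y\<bar> * (\<bar>1 - t\<bar> * \<bar>g y t - g y 0\<bar>) \<le> A * (1 + norm y) * (1 * (2 * ?G))"
      using A by (intro mult_mono [OF h_le *]) auto
    also have "\<dots> = D y"
      by (simp add: D_def power3_eq_cube power2_eq_square mult_ac)
    finally show ?thesis
      using True by (simp add: P_def abs_mult)
  qed (simp add: P_def)
  have P_int: "integrable (lborel \<Otimes>\<^sub>M lborel) (\<lambda>(t, y). P t y)"
  proof (rule lborel_pair.integrable_product_bound)
    show "integrable lborel (indicator {0..1} :: real \<Rightarrow> real)"
      by simp
    show "integrable lborel D"
      unfolding D_def [abs_def] by (intro integrable_mult_right integrable_one_plus_norm_power_exp) simp
  qed (use P_le in auto)
  let ?L = "(\<integral>y. h (y + w) \<partial>std_gaussian) - (\<integral>y. h y \<partial>std_gaussian)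
      - (\<integral>y. h y * (y \<bullet> w) \<partial>std_gaussian) - 1/2 * (\<integral>y. h y * q y \<partial>std_gaussian)"
  have density_int: "integrable lborel (\<lambda>y. gauss_density y * f y)"
    if "integrable std_gaussian f" "f \<in> borel_measurable borel" for f :: "real^'n \<Rightarrow> real"
    using that integrable_std_gaussian_iff by blast
  have L_eq: "?L = (\<integral>y. (\<integral>t. P t y \<partial>lborel) \<partial>lborel)"
  proof -
    have i0: "integrable lborel (\<lambda>y. gauss_density (y - w) * h y)"
      using density_int [OF int0 [of 1]] integral_lborel_translate(2) [of "\<lambda>y. gauss_density (y - w) * h y" w]
      by simp
    have i: "integrable lborel (\<lambda>y. gauss_density y * h y)" 
      "integrable lborel (\<lambda>y. gauss_density y * (h y * (y \<bullet> w)))"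
      "integrable lborel (\<lambda>y. gauss_density y * (h y * q y))"
      using density_int [OF int0 [of 0]] density_int [OF int1] density_int [OF int2 [of 0]] by simp_all
    have "(\<integral>y. h (y + w) \<partial>std_gaussian) = (\<integral>y. gauss_density (y - w) * h y \<partial>lborel)"
      using integral_lborel_translate(1) [of "\<lambda>y. gauss_density (y - w) * h y" w]
      by (simp add: integral_std_gaussian)
    then have "?L = (\<integral>y. gauss_density (y - w) * h y \<partial>lborel) - (\<integral>y. gauss_density y * h y \<partial>lborel)
      - (\<integral>y. gauss_density y * (h y * (y \<bullet> w)) \<partial>lborel) - (\<integral>y. 1/2 * (gauss_density y * (h y * q y)) \<partial>lborel)"
      by (simp add: integral_std_gaussian)
    also have "\<dots> = (\<integral>y. gauss_density (y - w) * h y - gauss_density y * h y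
      - gauss_density y * (h y * (y \<bullet> w)) - 1/2 * (gauss_density y * (h y * q y)) \<partial>lborel)"
      using i0 i by (simp add: Bochner_Integration.integral_diff)
    also have "\<dots> = (\<integral>y. (\<integral>t. P t y \<partial>lborel) \<partial>lborel)"
    proof (rule Bochner_Integration.integral_cong [OF refl])
      fix y
      show "gauss_density (y - w) * h y - gauss_density y * h y
        - gauss_density y * (h y * (y \<bullet> w)) - 1/2 * (gauss_density y * (h y * q y)) = (\<integral>t. P t y \<partial>lborel)"
        unfolding P_def integral_mult_right_zero g_def q_def
        by (subst gauss_density_taylor) (simp add: algebra_simps)
    qed
    finally show ?thesis .
  qed
  also have "\<dots> = (\<integral>t. (\<integral>y. P t y \<partial>lborel) \<partial>lborel)"
    using lborel_pair.Fubini_integral [OF P_int] .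
  finally have L: "?L = (\<integral>t. (\<integral>y. P t y \<partial>lborel) \<partial>lborel)" .
  define Q where "Q = (\<integral>y. \<bar>q y\<bar> \<partial>std_gaussian)"
  have inner_le: "\<bar>\<integral>y. P t y \<partial>lborel\<bar> \<le> (K * norm w * Q) * ((1 - t) * t * indicator {0..1} t)" for t
  proof (cases "t \<in> {0..1}")
    case True
    then have t: "0 \<le> t" "t \<le> 1" "\<bar>t\<bar> \<le> 1" by auto
    have it: "integrable lborel (\<lambda>y. h y * g y t)"
      using density_int [OF int2 [OF t(3)]] integral_lborel_translate(2) [of "\<lambda>y. h y * g y t" "t *\<^sub>R w"]
      by (simp add: g_def mult_ac)
    have i0: "integrable lborel (\<lambda>y. h y * g y 0)"
      using density_int [OF int2 [of 0]] by (simp add: g_def mult_ac)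
    have "(\<integral>y. h y * g y t \<partial>lborel) = (\<integral>y. h (y + t *\<^sub>R w) * q y \<partial>std_gaussian)"
      using integral_lborel_translate(1) [of "\<lambda>y. h y * g y t" "t *\<^sub>R w"]
      by (simp add: g_def integral_std_gaussian mult_ac)
    moreover have "(\<integral>y. h y * g y 0 \<partial>lborel) = (\<integral>y. h y * q y \<partial>std_gaussian)"
      by (simp add: g_def integral_std_gaussian mult_ac)
    moreover have "(\<integral>y. P t y \<partial>lborel) = (1 - t) * ((\<integral>y. h y * g y t \<partial>lborel) - (\<integral>y. h y * g y 0 \<partial>lborel))"
    proof -
      have "(\<integral>y. P t y \<partial>lborel) = (\<integral>y. (1 - t) * (h y * g y t - h y * g y 0) \<partial>lborel)"
        using True by (simp add: P_def algebra_simps)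
      then show ?thesis
        using it i0 by (simp add: Bochner_Integration.integral_diff)
    qed
    ultimately have "(\<integral>y. P t y \<partial>lborel)
        = (1 - t) * (\<integral>y. h (y + t *\<^sub>R w) * q y - h y * q y \<partial>std_gaussian)"
      using int2 [OF t(3)] int2 [of 0] by (simp add: Bochner_Integration.integral_diff)
    moreover have "\<bar>\<integral>y. h (y + t *\<^sub>R w) * q y - h y * q y \<partial>std_gaussian\<bar> \<le> (\<integral>y. (K * (t * norm w)) * \<bar>q y\<bar> \<partial>std_gaussian)"
    proof (rule order_trans [OF integral_abs_bound], rule integral_mono)
      show "integrable std_gaussian (\<lambda>y. \<bar>h (y + t *\<^sub>R w) * q y - h y * q y\<bar>)"
        using int2 [OF t(3)] int2 [of 0] by simp
      show "integrable std_gaussian (\<lambda>y. (K * (t * norm w)) * \<bar>q y\<bar>)"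
        using intq by (rule integrable_mult_right)
      fix y
      have "\<bar>h (y + t *\<^sub>R w) - h y\<bar> \<le> K * (t * norm w)"
        using lip [of "y + t *\<^sub>R w" y] t by (simp add: dist_norm)
      then show "\<bar>h (y + t *\<^sub>R w) * q y - h y * q y\<bar> \<le> (K * (t * norm w)) * \<bar>q y\<bar>"
        unfolding left_diff_distrib [symmetric] abs_mult by (rule mult_right_mono) simp
    qed
    ultimately have "\<bar>\<integral>y. P t y \<partial>lborel\<bar> \<le> (1 - t) * (K * (t * norm w) * Q)"
      using t by (simp add: abs_mult Q_def mult_left_mono)
    then show ?thesis
      using True by (simp add: mult_ac)
  qed (simp add: P_def)
  \<comment> \<open>The factor \<open>1 - t\<close> is the Taylor weight and \<open>t\<close> the
    Lipschitz gain of the second derivative; their integral is the source of the 6 in the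
    bound.\<close>
  have bump: "has_bochner_integral lborel (\<lambda>t. (1 - t) * t * indicator {0..1::real} t) (1 / 6)"
  proof -
    have "has_bochner_integral lborel (\<lambda>t. (1 - t) * t * indicator {0..1::real} t)
        ((1\<^sup>2 / 2 - 1 ^ 3 / 3) - (0\<^sup>2 / 2 - 0 ^ 3 / 3))"
      by (rule has_bochner_integral_FTC_Icc_real [where F = "\<lambda>t. t\<^sup>2 / 2 - t ^ 3 / 3"])
        (auto intro!: derivative_eq_intros simp: field_simps power2_eq_square)
    then show ?thesis by simp
  qed
  have "\<bar>?L\<bar> \<le> (\<integral>t. (K * norm w * Q) * ((1 - t) * t * indicator {0..1} t) \<partial>lborel)"
    unfolding L
  proof (rule order_trans [OF integral_abs_bound], rule integral_mono)
    show "integrable lborel (\<lambda>t. \<bar>\<integral>y. P t y \<partial>lborel\<bar>)"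
      using lborel_pair.integrable_fst [OF P_int] by simp
    show "integrable lborel (\<lambda>t. K * norm w * Q * ((1 - t) * t * indicator {0..1} t))"
      using bump by (intro integrable_mult_right) (simp add: has_bochner_integral_iff)
  qed (rule inner_le)
  also have "\<dots> = K * norm w * Q * (1 / 6)"
    unfolding integral_mult_right_zero has_bochner_integral_integral_eq [OF bump] ..
  finally show ?thesis
    by (simp add: q_def Q_def)
qed

section \<open>Rotation invariance and covariance\<close>

lemma nn_integral_lborel_affine:
  fixes f :: "'a::euclidean_space \<Rightarrow> ennreal"
  assumes [measurable]: "f \<in> borel_measurable borel" and c: "0 < c"
  shows "integral\<^sup>N lborel f = ennreal (c ^ DIM('a)) * (\<integral>\<^sup>+x. f (t + c *\<^sub>R x) \<partial>lborel)"
proof -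
  have "integral\<^sup>N lborel f
      = integral\<^sup>N (density (distr lborel borel (\<lambda>x::'a. t + c *\<^sub>R x)) (\<lambda>_. ennreal (\<bar>c\<bar> ^ DIM('a)))) f"
    using c by (subst lborel_affine [of c t, symmetric]) simp_all
  also have "\<dots> = ennreal (c ^ DIM('a)) * (\<integral>\<^sup>+x. f (t + c *\<^sub>R x) \<partial>lborel)"
    using c by (subst nn_integral_density) (simp_all add: nn_integral_distr nn_integral_cmult)
  finally show ?thesis .
qed

text \<open>Up to normalisation both sides are the joint density of two standard Gaussians
  \<open>z\<close> and \<open>u = t z + s y\<close> with correlation \<open>t\<close>, which is
  symmetric in the two vectors.\<close>

lemma gauss_density_rotate:
  fixes u z :: "real^'n"
  assumes "0 < s" "s\<^sup>2 + t\<^sup>2 = 1"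
  shows "gauss_density z * gauss_density ((1 / s) *\<^sub>R (u - t *\<^sub>R z))
    = gauss_density u * gauss_density ((1 / s) *\<^sub>R (z - t *\<^sub>R u))"
proof -
  have expand: "(norm ((1 / s) *\<^sub>R (b - t *\<^sub>R a)))\<^sup>2
      = ((norm b)\<^sup>2 - 2 * t * (a \<bullet> b) + t\<^sup>2 * (norm a)\<^sup>2) / s\<^sup>2" for a b :: "real^'n"
  proof -
    have "(norm (b - t *\<^sub>R a))\<^sup>2 = (norm b)\<^sup>2 - 2 * t * (a \<bullet> b) + t\<^sup>2 * (norm a)\<^sup>2"
      unfolding power2_norm_eq_inner
      by (simp add: inner_diff_left inner_diff_right inner_commute power2_eq_square algebra_simps)
    then show ?thesis
      by (simp add: power_divide power_mult_distrib)
  qed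
  have t: "t\<^sup>2 = 1 - s\<^sup>2"
    using assms(2) by simp
  have "(norm z)\<^sup>2 + (norm ((1 / s) *\<^sub>R (u - t *\<^sub>R z)))\<^sup>2
      = (norm u)\<^sup>2 + (norm ((1 / s) *\<^sub>R (z - t *\<^sub>R u)))\<^sup>2"
    unfolding expand t inner_commute [of z u] using assms(1) by (simp add: field_simps)
  then have *: "exp (- (norm z)\<^sup>2 / 2) * exp (- (norm ((1 / s) *\<^sub>R (u - t *\<^sub>R z)))\<^sup>2 / 2)
      = exp (- (norm u)\<^sup>2 / 2) * exp (- (norm ((1 / s) *\<^sub>R (z - t *\<^sub>R u)))\<^sup>2 / 2)"
    unfolding exp_add [symmetric] by (simp add: field_simps)
  have "c * a * (c * b) = c * a' * (c * b')" if "a * b = a' * b'" for c a b a' b' :: real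
    using arg_cong [OF that, of "\<lambda>v. c * c * v"] by (simp only: mult_ac)
  from this [OF *] show ?thesis
    unfolding gauss_density_def .
qed

text \<open>Substitute \<open>u = t z + s y\<close> for \<open>y\<close>, exchange the integrals and
  use the symmetry of the joint density: given \<open>u\<close>, the variable \<open>z\<close> is
  Gaussian around \<open>t u\<close> and integrates out to 1.\<close>

lemma nn_integral_std_gaussian_rotate:
  fixes f :: "real^'n \<Rightarrow> ennreal"
  assumes [measurable]: "f \<in> borel_measurable borel" and s: "0 < s" and st: "s\<^sup>2 + t\<^sup>2 = 1"
  shows "(\<integral>\<^sup>+z. (\<integral>\<^sup>+y. f (t *\<^sub>R z + s *\<^sub>R y) \<partial>std_gaussian) \<partial>std_gaussian) = integral\<^sup>N std_gaussian f"
proof -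
  define c where "c = ennreal ((1 / s) ^ CARD('n))"
  define k where "k z u = gauss_density ((1 / s) *\<^sub>R (u - t *\<^sub>R z))" for z u :: "real^'n"
  have [measurable]: "(\<lambda>p. k (fst p) (snd p)) \<in> borel_measurable (borel \<Otimes>\<^sub>M borel)"
    "k z \<in> borel_measurable borel" for z
    unfolding k_def by measurable
  have k_nonneg: "0 \<le> k z u" for z u
    by (simp add: k_def)
  have affine: "(\<integral>\<^sup>+y. F y \<partial>lborel) = c * (\<integral>\<^sup>+u. F ((1 / s) *\<^sub>R (u - t *\<^sub>R z)) \<partial>lborel)"
    if "F \<in> borel_measurable borel" for F :: "real^'n \<Rightarrow> ennreal" and z
    using nn_integral_lborel_affine [OF that, of "1 / s" "- ((t / s) *\<^sub>R z)"] s
    by (simp add: c_def scaleR_diff_right)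
  have "(\<integral>\<^sup>+z. (\<integral>\<^sup>+y. f (t *\<^sub>R z + s *\<^sub>R y) \<partial>std_gaussian) \<partial>std_gaussian)
      = (\<integral>\<^sup>+z. gauss_density z * (\<integral>\<^sup>+y. gauss_density y * f (t *\<^sub>R z + s *\<^sub>R y) \<partial>lborel) \<partial>lborel)"
    unfolding std_gaussian_density by (simp add: nn_integral_density)
  also have "\<dots> = (\<integral>\<^sup>+z. (\<integral>\<^sup>+u. c * (ennreal (gauss_density z * k z u) * f u) \<partial>lborel) \<partial>lborel)"
  proof (rule nn_integral_cong)
    fix z :: "real^'n"
    have "(\<integral>\<^sup>+y. gauss_density y * f (t *\<^sub>R z + s *\<^sub>R y) \<partial>lborel) = c * (\<integral>\<^sup>+u. k z u * f u \<partial>lborel)"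
      using s by (subst affine [of _ z]) (simp_all add: k_def)
    then have "gauss_density z * (\<integral>\<^sup>+y. gauss_density y * f (t *\<^sub>R z + s *\<^sub>R y) \<partial>lborel)
        = (gauss_density z * c) * (\<integral>\<^sup>+u. k z u * f u \<partial>lborel)"
      by (simp only: mult.assoc)
    also have "\<dots> = (\<integral>\<^sup>+u. (gauss_density z * c) * (k z u * f u) \<partial>lborel)"
      by (rule nn_integral_cmult [symmetric]) measurable
    also have "\<dots> = (\<integral>\<^sup>+u. c * (ennreal (gauss_density z * k z u) * f u) \<partial>lborel)"
      by (simp only: ennreal_mult [OF gauss_density_nonneg k_nonneg] mult_ac)
    finally show "gauss_density z * (\<integral>\<^sup>+y. gauss_density y * f (t *\<^sub>R z + s *\<^sub>R y) \<partial>lborel)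
        = (\<integral>\<^sup>+u. c * (ennreal (gauss_density z * k z u) * f u) \<partial>lborel)" .
  qed
  also have "\<dots> = (\<integral>\<^sup>+u. (\<integral>\<^sup>+z. c * (ennreal (gauss_density z * k z u) * f u) \<partial>lborel) \<partial>lborel)"
    by (rule lborel_pair.Fubini') (unfold k_def, measurable)
  also have "\<dots> = (\<integral>\<^sup>+u. gauss_density u * f u \<partial>lborel)"
  proof (rule nn_integral_cong)
    fix u :: "real^'n"
    have "(\<integral>\<^sup>+z. c * (ennreal (gauss_density z * k z u) * f u) \<partial>lborel)
        = (\<integral>\<^sup>+z. (gauss_density u * f u) * (c * k u z) \<partial>lborel)"
      unfolding k_def gauss_density_rotate [OF s st, of _ u]
      by (simp only: ennreal_mult [OF gauss_density_nonneg gauss_density_nonneg] mult_ac)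
    also have "\<dots> = (gauss_density u * f u) * (c * (\<integral>\<^sup>+z. k u z \<partial>lborel))"
      by (simp add: nn_integral_cmult)
    \<comment> \<open>\<open>c\<close> is the Jacobian of the affine substitution, so this is the
      total mass of the standard Gaussian after a change of variables.\<close>
    also have "c * (\<integral>\<^sup>+z. k u z \<partial>lborel) = 1"
      using affine [of "\<lambda>x. ennreal (gauss_density x)" u] by (simp add: nn_integral_gauss_density k_def)
    finally show "(\<integral>\<^sup>+z. c * (ennreal (gauss_density z * k z u) * f u) \<partial>lborel) = gauss_density u * f u"
      by simp
  qed
  also have "\<dots> = integral\<^sup>N std_gaussian f"
    unfolding std_gaussian_density by (simp add: nn_integral_density)
  finally show ?thesis .
qed

text \<open>Turns the identity for nonnegative integrands into an equality of laws, which then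
  transfers to integrable functions of either sign.\<close>

lemma distr_std_gaussian_rotate:
  assumes "0 < s" "s\<^sup>2 + t\<^sup>2 = 1"
  shows "distr (std_gaussian \<Otimes>\<^sub>M std_gaussian) borel (\<lambda>(z, y). t *\<^sub>R z + s *\<^sub>R y :: real^'n) = std_gaussian"
proof (rule measure_eqI)
  interpret N: prob_space "std_gaussian :: (real^'n) measure"
    by (rule prob_space_std_gaussian)
  fix A assume "A \<in> sets (distr (std_gaussian \<Otimes>\<^sub>M std_gaussian) borel (\<lambda>(z, y). t *\<^sub>R z + s *\<^sub>R y :: real^'n))"
  then have A [measurable]: "A \<in> sets borel" by simp
  let ?D = "distr (std_gaussian \<Otimes>\<^sub>M std_gaussian) borel (\<lambda>(z, y). t *\<^sub>R z + s *\<^sub>R y :: real^'n)"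
  have "emeasure ?D A = (\<integral>\<^sup>+x. indicator A x \<partial>?D)"
    by simp
  also have "\<dots> = (\<integral>\<^sup>+p. indicator A (t *\<^sub>R fst p + s *\<^sub>R snd p) \<partial>(std_gaussian \<Otimes>\<^sub>M std_gaussian))"
    by (subst nn_integral_distr) (simp_all add: case_prod_beta')
  also have "\<dots> = (\<integral>\<^sup>+z. (\<integral>\<^sup>+y. indicator A (t *\<^sub>R z + s *\<^sub>R y) \<partial>std_gaussian) \<partial>std_gaussian)"
    by (subst N.nn_integral_fst [symmetric]) simp_all
  also have "\<dots> = (\<integral>\<^sup>+x. indicator A x \<partial>std_gaussian)"
    by (rule nn_integral_std_gaussian_rotate [OF _ assms]) simp
  finally show "emeasure ?D A = emeasure std_gaussian A"
    by simp
qed simp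

lemma integral_std_gaussian_rotate:
  fixes f :: "real^'n \<Rightarrow> real"
  assumes f: "integrable std_gaussian f" and st: "0 < s" "s\<^sup>2 + t\<^sup>2 = 1"
  shows "(\<integral>z. (\<integral>y. f (t *\<^sub>R z + s *\<^sub>R y) \<partial>std_gaussian) \<partial>std_gaussian) = integral\<^sup>L std_gaussian f"
proof -
  interpret N: prob_space "std_gaussian :: (real^'n) measure"
    by (rule prob_space_std_gaussian)
  interpret NN: pair_sigma_finite "std_gaussian :: (real^'n) measure" "std_gaussian :: (real^'n) measure" ..
  have [measurable]: "f \<in> borel_measurable borel"
    using borel_measurable_integrable [OF f] by simp
  have "integrable (std_gaussian \<Otimes>\<^sub>M std_gaussian) (\<lambda>(z, y). f (t *\<^sub>R z + s *\<^sub>R y))"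
    using f by (subst (asm) distr_std_gaussian_rotate [OF st, symmetric], subst (asm) integrable_distr_eq)
      (simp_all add: case_prod_beta')
  from NN.integral_fst [OF this]
  have "(\<integral>z. (\<integral>y. f (t *\<^sub>R z + s *\<^sub>R y) \<partial>std_gaussian) \<partial>std_gaussian)
      = (\<integral>p. f (t *\<^sub>R fst p + s *\<^sub>R snd p) \<partial>(std_gaussian \<Otimes>\<^sub>M std_gaussian))"
    by (simp add: case_prod_beta')
  also have "\<dots> = integral\<^sup>L (distr (std_gaussian \<Otimes>\<^sub>M std_gaussian) borel (\<lambda>(z, y). t *\<^sub>R z + s *\<^sub>R y)) f"
    by (subst integral_distr) (simp_all add: case_prod_beta')
  finally show ?thesis
    unfolding distr_std_gaussian_rotate [OF st] .
qed

lemma integrable_std_gaussian_inner: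
  fixes w :: "real^'n"
  shows "integrable std_gaussian (\<lambda>y. y \<bullet> w)" "integrable std_gaussian (\<lambda>y. (y \<bullet> w)\<^sup>2)"
proof -
  have le: "\<bar>y \<bullet> w\<bar> \<le> norm w * (1 + norm y)" for y
    using Cauchy_Schwarz_ineq2 [of y w] by (simp add: algebra_simps) (smt (verit) norm_ge_zero)
  then show "integrable std_gaussian (\<lambda>y. y \<bullet> w)"
    by (intro integrable_std_gaussian_polynomial_growth [where k = 1 and C = "norm w"]) auto
  show "integrable std_gaussian (\<lambda>y. (y \<bullet> w)\<^sup>2)"
    using power_mono [OF le abs_ge_zero, of _ 2]
    by (intro integrable_std_gaussian_polynomial_growth [where k = 2 and C = "(norm w)\<^sup>2"])
      (auto simp: power_mult_distrib)
qed

lemma std_gaussian_inner_moments: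
  fixes w :: "real^'n"
  shows "(\<integral>y. y \<bullet> w \<partial>std_gaussian) = 0" "(\<integral>y. (y \<bullet> w)\<^sup>2 \<partial>std_gaussian) = (norm w)\<^sup>2"
proof -
  interpret N: prob_space "std_gaussian :: (real^'n) measure"
    by (rule prob_space_std_gaussian)
  \<comment> \<open>the Taylor expansion of the constant function 1 has no remainder\<close>
  have *: "(\<integral>y. y \<bullet> v \<partial>std_gaussian) + 1/2 * ((\<integral>y. (y \<bullet> v)\<^sup>2 \<partial>std_gaussian) - (norm v)\<^sup>2) = 0" for v :: "real^'n"
    using std_gaussian_taylor [of "\<lambda>_. 1" 0 v] integrable_std_gaussian_inner [of v]
    by (simp add: N.prob_space [simplified] field_simps)
  \<comment> \<open>The first moment is odd in the direction and the second is even, so the two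
    instances determine both.\<close>
  from * [of w] * [of "- w"]
  show "(\<integral>y. y \<bullet> w \<partial>std_gaussian) = 0" "(\<integral>y. (y \<bullet> w)\<^sup>2 \<partial>std_gaussian) = (norm w)\<^sup>2"
    by simp_all
qed

text \<open>What the replacement argument uses about the law of one summand. The Gaussian and the
  law of the \<open>\<xi> i\<close> are both instances, so each expansion is proved once and applied
  twice.\<close>

locale isotropic_law = prob_space \<mu> for \<mu> :: "(real^'n) measure" +
  assumes sets_law [measurable_cong, simp]: "sets \<mu> = sets borel"
    and third_moment: "integrable \<mu> (\<lambda>z. norm z ^ 3)"
    and mean_zero: "\<And>j. (\<integral>z. z $ j \<partial>\<mu>) = 0"
    and covariance: "\<And>j k. (\<integral>z. z $ j * z $ k \<partial>\<mu>) = (if j = k then 1 else 0)"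

lemma isotropic_law_std_gaussian: "isotropic_law (std_gaussian :: (real^'n) measure)"
proof -
  interpret prob_space "std_gaussian :: (real^'n) measure"
    by (rule prob_space_std_gaussian)
  show ?thesis
  proof
    show "integrable std_gaussian (\<lambda>z::real^'n. norm z ^ 3)"
      by (rule integrable_std_gaussian_polynomial_growth [where k = 3 and C = 1]) (auto intro: power_mono)
    fix j k :: 'n
    show "(\<integral>z. z $ j \<partial>std_gaussian) = 0"
      using std_gaussian_inner_moments(1) [of "axis j 1"] by (simp add: inner_axis)
    show "(\<integral>z. z $ j * z $ k \<partial>std_gaussian) = (if j = k then 1 else 0)"
    proof -
      \<comment> \<open>Polarisation: the mixed moment is a quarter of the difference between the
        second moments along the sum and the difference of the two axes.\<close>
      let ?p = "axis j 1 + axis k 1 :: real^'n" and ?m = "axis j 1 - axis k 1 :: real^'n"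
      have "z $ j * z $ k = ((z \<bullet> ?p)\<^sup>2 - (z \<bullet> ?m)\<^sup>2) / 4" for z :: "real^'n"
        by (simp add: inner_axis inner_add_right inner_diff_right power2_eq_square algebra_simps)
      then have "(\<integral>z. z $ j * z $ k \<partial>std_gaussian) = (\<integral>z. ((z \<bullet> ?p)\<^sup>2 - (z \<bullet> ?m)\<^sup>2) / 4 \<partial>std_gaussian)"
        by (simp only:)
      also have "\<dots> = ((norm ?p)\<^sup>2 - (norm ?m)\<^sup>2) / 4"
        by (simp add: integrable_std_gaussian_inner std_gaussian_inner_moments)
      also have "\<dots> = axis j 1 \<bullet> (axis k 1 :: real^'n)"
        unfolding power2_norm_eq_inner
        by (simp add: inner_add_left inner_add_right inner_diff_left inner_diff_right inner_commute)
      finally show ?thesis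
        by (simp add: inner_axis_axis)
    qed
  qed simp
qed

section \<open>One-dimensional marginals\<close>

lemma gauss_density_prod: "gauss_density (x::real^'n) = (\<Prod>b\<in>Basis. std_normal_density (x \<bullet> b))"
proof -
  have "sqrt (2 * pi) ^ CARD('n) = (2 * pi) powr (real CARD('n) / 2)"
    by (simp add: powr_half_sqrt [symmetric] powr_power mult.commute)
  then have "(1 / sqrt (2 * pi)) ^ CARD('n) = (2 * pi) powr (- real CARD('n) / 2)"
    by (simp add: power_one_over powr_minus inverse_eq_divide)
  moreover have "(\<Prod>b\<in>Basis. std_normal_density (x \<bullet> b))
      = (1 / sqrt (2 * pi)) ^ CARD('n) * (\<Prod>b\<in>Basis. exp (- (x \<bullet> b)\<^sup>2 / 2))"
    unfolding std_normal_density_def prod.distrib prod_constant by simp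
  ultimately show ?thesis
    using exp_norm_square_prod [of "1/2" x] by (simp add: gauss_density_def)
qed

text \<open>The density factorises over coordinates. Leaving all sides but one unrestricted yields
  the marginals; general sides yield independence.\<close>

lemma emeasure_std_gaussian_box:
  assumes [measurable]: "\<And>b. b \<in> Basis \<Longrightarrow> A b \<in> sets borel"
  shows "emeasure std_gaussian {x::real^'n. \<forall>b\<in>Basis. x \<bullet> b \<in> A b}
    = (\<Prod>b\<in>Basis. emeasure (density lborel std_normal_density) (A b))"
proof -
  have [measurable]: "{x::real^'n. \<forall>b\<in>Basis. x \<bullet> b \<in> A b} \<in> sets borel"
    by measurable
  have "ennreal (gauss_density x) * indicator {x::real^'n. \<forall>b\<in>Basis. x \<bullet> b \<in> A b} x
      = (\<Prod>b\<in>Basis. ennreal (std_normal_density (x \<bullet> b)) * indicator (A b) (x \<bullet> b))" for x :: "real^'n"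
  proof -
    have "indicator {x::real^'n. \<forall>b\<in>Basis. x \<bullet> b \<in> A b} x = (\<Prod>b\<in>Basis. indicator (A b) (x \<bullet> b) :: ennreal)"
      by (auto simp: indicator_def)
    then show ?thesis
      by (simp add: gauss_density_prod prod_ennreal prod.distrib)
  qed
  then have "emeasure std_gaussian {x::real^'n. \<forall>b\<in>Basis. x \<bullet> b \<in> A b}
      = (\<integral>\<^sup>+(x::real^'n). (\<Prod>b\<in>Basis. ennreal (std_normal_density (x \<bullet> b)) * indicator (A b) (x \<bullet> b)) \<partial>lborel)"
    by (simp add: std_gaussian_density emeasure_density)
  also have "\<dots> = (\<Prod>b\<in>(Basis::(real^'n) set). \<integral>\<^sup>+t. ennreal (std_normal_density t) * indicator (A b) t \<partial>lborel)"
    by (rule nn_integral_lborel_prod) simp_all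
  finally show ?thesis
    by (simp add: emeasure_density)
qed

lemma std_gaussian_coordinate_distributed:
  fixes b :: "real^'n"
  assumes b: "b \<in> Basis"
  shows "distributed std_gaussian lborel (\<lambda>x. x \<bullet> b) std_normal_density"
  unfolding distributed_def
proof (intro conjI measure_eqI)
  fix A assume "A \<in> sets (distr std_gaussian lborel (\<lambda>x. x \<bullet> b))"
  then have A [measurable]: "A \<in> sets borel" by simp
  interpret prob_space "density lborel std_normal_density"
    by (rule prob_space_normal_density) simp
  let ?A = "\<lambda>c. if c = b then A else UNIV"
  have "emeasure (distr std_gaussian lborel (\<lambda>x. x \<bullet> b)) A
      = emeasure std_gaussian {x::real^'n. \<forall>c\<in>Basis. x \<bullet> c \<in> ?A c}"
    using b by (simp add: emeasure_distr) (auto intro!: arg_cong [where f = "emeasure std_gaussian"])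
  also have "\<dots> = (\<Prod>c\<in>Basis. emeasure (density lborel std_normal_density) (?A c))"
    by (rule emeasure_std_gaussian_box) simp
  also have "\<dots> = (\<Prod>c\<in>Basis. if c = b then emeasure (density lborel std_normal_density) A else 1)"
    using emeasure_space_1 by (intro prod.cong) auto
  also have "\<dots> = emeasure (density lborel std_normal_density) A"
    using b by simp
  finally show "emeasure (distr std_gaussian lborel (\<lambda>x. x \<bullet> b)) A = emeasure (density lborel std_normal_density) A" .
qed simp_all

text \<open>The Borel sets serve as their own intersection-stable generator, so it is enough that
  boxes have product measure.\<close>

lemma std_gaussian_coordinates_indep:
  "prob_space.indep_vars std_gaussian (\<lambda>_. borel) (\<lambda>b x. x \<bullet> b) (Basis :: (real^'n) set)"
proof -
  interpret prob_space "std_gaussian :: (real^'n) measure"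
    by (rule prob_space_std_gaussian)
  have single: "emeasure std_gaussian {x::real^'n. x \<bullet> b \<in> A} = emeasure (density lborel std_normal_density) A"
    if "b \<in> Basis" "A \<in> sets borel" for b A
    using arg_cong [OF distributed_distr_eq_density [OF std_gaussian_coordinate_distributed [OF that(1)]],
        where f = "\<lambda>M. emeasure M A"] that(2)
    by (simp add: emeasure_distr vimage_def)
  have "prob (\<Inter>b\<in>Basis. (\<lambda>x. x \<bullet> b) -` A b \<inter> space std_gaussian)
      = (\<Prod>b\<in>Basis. prob ((\<lambda>x. x \<bullet> b) -` A b \<inter> space std_gaussian))"
    if A: "A \<in> Basis \<rightarrow> sets borel" for A
  proof -
    have "emeasure std_gaussian {x::real^'n. \<forall>b\<in>Basis. x \<bullet> b \<in> A b}
        = (\<Prod>b\<in>Basis. emeasure (density lborel std_normal_density) (A b))"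
      using A by (intro emeasure_std_gaussian_box) auto
    also have "\<dots> = (\<Prod>b\<in>(Basis::(real^'n) set). emeasure std_gaussian {x::real^'n. x \<bullet> b \<in> A b})"
      using A by (intro prod.cong refl single [symmetric]) auto
    finally have "prob {x::real^'n. \<forall>b\<in>Basis. x \<bullet> b \<in> A b} = (\<Prod>b\<in>Basis. prob {x::real^'n. x \<bullet> b \<in> A b})"
      by (simp add: emeasure_eq_measure prod_ennreal prod_nonneg)
    moreover have "(\<Inter>b\<in>Basis. (\<lambda>x. x \<bullet> b) -` A b \<inter> space std_gaussian) = {x::real^'n. \<forall>b\<in>Basis. x \<bullet> b \<in> A b}"
      by auto
    ultimately show ?thesis
      by (simp add: vimage_def)
  qed
  then show ?thesis
    by (subst indep_vars_finite [where E = "\<lambda>_. sets borel"])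
      (auto simp: sets.sigma_sets_eq [of borel, simplified] intro: sets.Int_stable)
qed

text \<open>The inner product is a weighted sum of independent normal coordinates, hence normal; its
  variance is the sum of the squared weights, which is 1 for a unit vector.\<close>

lemma std_gaussian_inner_distributed:
  fixes w :: "real^'n"
  assumes "norm w = 1"
  shows "distributed std_gaussian lborel (\<lambda>x. x \<bullet> w) std_normal_density"
proof -
  interpret prob_space "std_gaussian :: (real^'n) measure"
    by (rule prob_space_std_gaussian)
  \<comment> \<open>Coordinates of weight zero are dropped: multiplied by zero, they no longer have
    a normal density.\<close>
  define I where "I = {b\<in>Basis. w \<bullet> b \<noteq> 0}"
  have I: "finite I" "I \<subseteq> Basis"
    by (auto simp: I_def)
  have sq: "(\<Sum>b\<in>I. \<bar>w \<bullet> b\<bar>\<^sup>2) = 1"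
  proof -
    have "(\<Sum>b\<in>I. \<bar>w \<bullet> b\<bar>\<^sup>2) = (\<Sum>b\<in>Basis. (w \<bullet> b) * (w \<bullet> b))"
      by (rule sum.mono_neutral_cong_left) (auto simp: I_def power2_eq_square)
    also have "\<dots> = w \<bullet> w"
      by (rule euclidean_inner [symmetric])
    finally show ?thesis
      using assms by (simp add: dot_square_norm)
  qed
  have "indep_vars (\<lambda>_. borel) (\<lambda>b x. 0 + (w \<bullet> b) * (x \<bullet> b)) I"
    by (rule indep_vars_compose2 [OF indep_vars_subset [OF std_gaussian_coordinates_indep I(2)]]) simp
  moreover have "distributed std_gaussian lborel (\<lambda>x. 0 + (w \<bullet> b) * (x \<bullet> b)) (normal_density (0 + (w \<bullet> b) * 0) (\<bar>w \<bullet> b\<bar> * 1))"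
    if "b \<in> I" for b
    using that std_gaussian_coordinate_distributed [of b] by (intro normal_density_affine) (auto simp: I_def)
  moreover have "I \<noteq> {}"
    using sq by auto
  ultimately have "distributed std_gaussian lborel (\<lambda>x. \<Sum>b\<in>I. 0 + (w \<bullet> b) * (x \<bullet> b))
      (normal_density (\<Sum>b\<in>I. 0 + (w \<bullet> b) * 0) (sqrt (\<Sum>b\<in>I. (\<bar>w \<bullet> b\<bar> * 1)\<^sup>2)))"
    using I by (intro sum_indep_normal) (auto simp: I_def)
  moreover have "(\<Sum>b\<in>I. 0 + (w \<bullet> b) * (x \<bullet> b)) = x \<bullet> w" for x
    unfolding euclidean_inner [of x w] by (rule sum.mono_neutral_cong_left) (auto simp: I_def)
  ultimately show ?thesis
    using sq by simp
qed

text \<open>Write the absolute value as \<open>t^2 - 1\<close> plus twice \<open>1 - t^2\<close> on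
  the interval from -1 to 1. The first part has mean 0, and \<open>t * std_normal_density t\<close>
  is a primitive for the second, so the exact value is
  \<open>4 * std_normal_density 1\<close>.\<close>

lemma std_normal_abs_square_minus_one_le:
  "(\<integral>t. std_normal_density t * \<bar>t\<^sup>2 - 1\<bar> \<partial>lborel) \<le> 1"
proof -
  have "has_bochner_integral lborel (\<lambda>t. std_normal_density t * t\<^sup>2 - std_normal_density t) (1 - 1)"
    using std_normal_moment_even [of 1] std_normal_moment_even [of 0]
    by (intro has_bochner_integral_diff) (simp_all add: fact_numeral)
  moreover have "has_bochner_integral lborel (\<lambda>t. (1 - t\<^sup>2) * std_normal_density t * indicator {-1..1} t)
      (1 * std_normal_density 1 - (-1) * std_normal_density (-1))"
  proof (rule has_bochner_integral_FTC_Icc_real [where F = "\<lambda>t. t * std_normal_density t"])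
    fix t
    show "((\<lambda>t. t * std_normal_density t) has_real_derivative (1 - t\<^sup>2) * std_normal_density t) (at t)"
      unfolding std_normal_density_def
      by (rule derivative_eq_intros refl | simp)+ (simp add: field_simps power2_eq_square)
    show "isCont (\<lambda>t. (1 - t\<^sup>2) * std_normal_density t) t"
      unfolding std_normal_density_def by (intro continuous_intros) auto
  qed simp
  ultimately have "has_bochner_integral lborel (\<lambda>t. (std_normal_density t * t\<^sup>2 - std_normal_density t)
      + 2 * ((1 - t\<^sup>2) * std_normal_density t * indicator {-1..1} t))
      ((1 - 1) + 2 * (1 * std_normal_density 1 - (-1) * std_normal_density (-1)))"
    by (intro has_bochner_integral_add has_bochner_integral_mult_right) auto
  moreover have "(std_normal_density t * t\<^sup>2 - std_normal_density t)
      + 2 * ((1 - t\<^sup>2) * std_normal_density t * indicator {-1..1} t) = std_normal_density t * \<bar>t\<^sup>2 - 1\<bar>" for t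
  proof (cases "\<bar>t\<bar> \<le> 1")
    case True
    then have "t\<^sup>2 \<le> 1" "t \<in> {-1..1}"
      by (auto simp: abs_square_le_1)
    then show ?thesis
      by (simp add: algebra_simps)
  next
    case False
    then have "1 < t\<^sup>2" "t \<notin> {-1..1}"
      using abs_square_le_1 [of t] by auto
    then show ?thesis
      by (simp add: algebra_simps)
  qed
  ultimately have "(\<integral>t. std_normal_density t * \<bar>t\<^sup>2 - 1\<bar> \<partial>lborel) = 4 * std_normal_density 1"
    by (simp add: has_bochner_integral_iff std_normal_density_def)
  also have "\<dots> \<le> 1"
  proof -
    \<comment> \<open>The claim amounts to \<open>16 \<le> 2 * pi * exp 1\<close>, which follows
      from \<open>pi \<ge> 3\<close> and \<open>exp 1 \<ge> 8 / 3\<close>.\<close>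
    have "8 \<le> 3 * exp (1::real)"
    proof -
      have "5837465777 / 2147483648 - inverse (2 ^ 32) \<le> exp (1::real)"
        using e_approx_32 by linarith
      then show ?thesis by simp
    qed
    also have "\<dots> \<le> pi * exp 1"
      using pi_approx by (intro mult_right_mono) auto
    finally have "4\<^sup>2 \<le> (sqrt (2 * pi) * exp (1/2))\<^sup>2"
      by (simp add: power_mult_distrib exp_double [symmetric])
    then have "4 \<le> sqrt (2 * pi) * exp (1/2)"
      by (rule power2_le_imp_le) simp
    then show ?thesis
      by (simp add: std_normal_density_def exp_minus field_simps)
  qed
  finally show ?thesis .
qed

text \<open>The exact value is \<open>4 \<phi>(1) |w|\<^sup>2\<close>, with \<open>4 \<phi>(1) = 4 / sqrt (2 \<pi> e) \<approx> 0.968\<close>.\<close>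

lemma integral_abs_gaussian_hermite2_le:
  fixes w :: "real^'n"
  shows "(\<integral>y. \<bar>(y \<bullet> w)\<^sup>2 - (norm w)\<^sup>2\<bar> \<partial>std_gaussian) \<le> (norm w)\<^sup>2"
proof (cases "w = 0")
  case False
  define v where "v = (1 / norm w) *\<^sub>R w"
  have v: "norm v = 1" and w: "w = norm w *\<^sub>R v"
    using False by (simp_all add: v_def)
  have "(y \<bullet> w)\<^sup>2 - (norm w)\<^sup>2 = (norm w)\<^sup>2 * ((y \<bullet> v)\<^sup>2 - 1)" for y
    by (subst w) (simp add: v power_mult_distrib right_diff_distrib)
  then have "(\<integral>y. \<bar>(y \<bullet> w)\<^sup>2 - (norm w)\<^sup>2\<bar> \<partial>std_gaussian) = (norm w)\<^sup>2 * (\<integral>y. \<bar>(y \<bullet> v)\<^sup>2 - 1\<bar> \<partial>std_gaussian)"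
    by (simp add: abs_mult)
  also have "(\<integral>y. \<bar>(y \<bullet> v)\<^sup>2 - 1\<bar> \<partial>std_gaussian) = (\<integral>t. std_normal_density t * \<bar>t\<^sup>2 - 1\<bar> \<partial>lborel)"
    by (rule distributed_integral [OF std_gaussian_inner_distributed [OF v], symmetric]) simp_all
  also have "(norm w)\<^sup>2 * \<dots> \<le> (norm w)\<^sup>2 * 1"
    by (intro mult_left_mono std_normal_abs_square_minus_one_le) simp
  finally show ?thesis by simp
qed simp

text \<open>The norm dominates any single coordinate, whose mean absolute value is
  \<open>sqrt (2 / pi)\<close>; the rational bound 3/4 is valid because
  \<open>9 * pi \<le> 32\<close>.\<close>

lemma std_gaussian_norm_ge: "3 / 4 \<le> (\<integral>x. norm (x::real^'n) \<partial>std_gaussian)"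
proof -
  obtain b :: "real^'n" where b: "b \<in> Basis"
    using nonempty_Basis by blast
  have "pi * 9 \<le> 32"
    using pi_approx by simp
  then have "(3 / 4)\<^sup>2 \<le> 2 / pi"
    by (simp add: field_simps power2_eq_square)
  then have "3 / 4 \<le> sqrt (2 / pi)"
    by (rule real_le_rsqrt)
  also have "\<dots> = (\<integral>t. std_normal_density t * \<bar>t\<bar> \<partial>lborel)"
    using integral_std_normal_moment_abs_odd [of 0] by simp
  also have "\<dots> = (\<integral>x. \<bar>x \<bullet> b\<bar> \<partial>std_gaussian)"
    by (rule distributed_integral [OF std_gaussian_coordinate_distributed [OF b]]) simp_all
  also have "\<dots> \<le> (\<integral>x. norm (x::real^'n) \<partial>std_gaussian)"
    using b
    by (intro integral_mono integrable_abs integrable_std_gaussian_inner Basis_le_norm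
        integrable_std_gaussian_polynomial_growth [where k = 1 and C = 1]) auto
  finally show ?thesis .
qed

section \<open>Gaussian smoothing of Lipschitz functions\<close>

context isotropic_law
begin

lemma space_law [simp]: "space \<mu> = UNIV"
  using sets_eq_imp_space_eq [OF sets_law] by simp

text \<open>Since \<open>t ^ k\<close> is at most \<open>1 + t ^ 3\<close> for
  \<open>k \<le> 3\<close>, the third moment controls all lower ones.\<close>

lemma integrable_of_norm_power_bound:
  fixes f :: "real^'n \<Rightarrow> real"
  assumes [measurable]: "f \<in> borel_measurable borel" and le: "\<And>z. \<bar>f z\<bar> \<le> C * norm z ^ k" and k: "k \<le> 3" and C: "0 \<le> C"
  shows "integrable \<mu> f"
proof (rule Bochner_Integration.integrable_bound)
  show "integrable \<mu> (\<lambda>z. C * (1 + norm z ^ 3))"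
    using third_moment by simp
  have pow: "t ^ k \<le> 1 + t ^ 3" if "0 \<le> t" for t :: real
  proof (cases "t \<le> 1")
    case True
    then have "t ^ k \<le> 1"
      using that by (simp add: power_le_one)
    then show ?thesis
      using that zero_le_power [OF that, of 3] by linarith
  next
    case False
    then have "t ^ k \<le> t ^ 3"
      using k by (intro power_increasing) auto
    then show ?thesis by simp
  qed
  have "\<bar>f z\<bar> \<le> \<bar>C * (1 + norm z ^ 3)\<bar>" for z
    using order_trans [OF le mult_left_mono [OF pow [OF norm_ge_zero] C]] by (rule order_trans) simp
  then show "AE z in \<mu>. norm (f z) \<le> norm (C * (1 + norm z ^ 3))"
    by simp
qed measurable

lemma integrable_components:
  "integrable \<mu> (\<lambda>z. z $ j)" "integrable \<mu> (\<lambda>z. z $ j * z $ k)" "integrable \<mu> norm"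
proof -
  show "integrable \<mu> (\<lambda>z. z $ j)"
    by (rule integrable_of_norm_power_bound [where k = 1 and C = 1]) (auto simp: component_le_norm_cart)
  show "integrable \<mu> norm"
    by (rule integrable_of_norm_power_bound [where k = 1 and C = 1]) auto
  show "integrable \<mu> (\<lambda>z. z $ j * z $ k)"
    by (rule integrable_of_norm_power_bound [where k = 2 and C = 1])
      (auto simp: power2_eq_square abs_mult intro!: mult_mono component_le_norm_cart)
qed

lemma integrable_lipschitz:
  fixes f :: "real^'n \<Rightarrow> real"
  assumes lip: "\<And>x y. \<bar>f x - f y\<bar> \<le> K * dist x y"
  shows "integrable \<mu> f"
proof -
  have "integrable \<mu> (\<lambda>z. f z - f 0)"
  proof (rule Bochner_Integration.integrable_bound [OF integrable_mult_right [OF integrable_components(3), of K]])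
    show "(\<lambda>z. f z - f 0) \<in> borel_measurable \<mu>"
      using lipschitz_borel_measurable [OF lip] by simp
    show "AE z in \<mu>. norm (f z - f 0) \<le> norm (K * norm z)"
      using order_trans [OF lip [of _ 0] abs_ge_self] by (intro AE_I2) simp
  qed
  from Bochner_Integration.integrable_add [OF this integrable_const [of "f 0"]] show ?thesis
    by simp
qed

end

text \<open>Convolution with the centred Gaussian of covariance \<open>s^2\<close> times the
  identity. Parametrising by the standard deviation lets \<open>s = 0\<close> stand for no
  smoothing.\<close>

definition gauss_smooth :: "real \<Rightarrow> (real^'n \<Rightarrow> real) \<Rightarrow> real^'n \<Rightarrow> real" where
  "gauss_smooth s h x = (\<integral>y. h (x + s *\<^sub>R y) \<partial>std_gaussian)"

lemma integrable_std_gaussian_lipschitz_affine: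
  fixes h :: "real^'n \<Rightarrow> real"
  assumes lip: "\<And>x y. \<bar>h x - h y\<bar> \<le> dist x y"
  shows "integrable std_gaussian (\<lambda>y. h (x + s *\<^sub>R y))"
proof -
  interpret N: isotropic_law "std_gaussian :: (real^'n) measure"
    by (rule isotropic_law_std_gaussian)
  show ?thesis
  proof (rule N.integrable_lipschitz)
    fix y z
    show "\<bar>h (x + s *\<^sub>R y) - h (x + s *\<^sub>R z)\<bar> \<le> \<bar>s\<bar> * dist y z"
      using lip [of "x + s *\<^sub>R y" "x + s *\<^sub>R z"] by (simp add: dist_norm flip: scaleR_diff_right)
  qed
qed

lemma gauss_smooth_lipschitz:
  fixes h :: "real^'n \<Rightarrow> real"
  assumes lip: "\<And>x y. \<bar>h x - h y\<bar> \<le> dist x y"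
  shows "\<bar>gauss_smooth s h x - gauss_smooth s h y\<bar> \<le> dist x y"
proof -
  interpret N: prob_space "std_gaussian :: (real^'n) measure"
    by (rule prob_space_std_gaussian)
  note int = integrable_std_gaussian_lipschitz_affine [OF lip, of _ s]
  have "gauss_smooth s h x - gauss_smooth s h y = (\<integral>v. h (x + s *\<^sub>R v) - h (y + s *\<^sub>R v) \<partial>std_gaussian)"
    by (simp add: gauss_smooth_def int)
  also have "\<bar>\<dots>\<bar> \<le> (\<integral>v. dist x y \<partial>(std_gaussian :: (real^'n) measure))"
  proof (rule order_trans [OF integral_abs_bound], rule integral_mono)
    fix v
    show "\<bar>h (x + s *\<^sub>R v) - h (y + s *\<^sub>R v)\<bar> \<le> dist x y"
      using lip [of "x + s *\<^sub>R v" "y + s *\<^sub>R v"] by simp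
  qed (simp_all add: int)
  finally show ?thesis
    by (simp add: N.prob_space [simplified])
qed

lemma gauss_smooth_0: "gauss_smooth 0 h x = h (x :: real^'n)"
proof -
  interpret N: prob_space "std_gaussian :: (real^'n) measure"
    by (rule prob_space_std_gaussian)
  show ?thesis
    by (simp add: gauss_smooth_def N.prob_space [simplified])
qed

text \<open>Variances of independent Gaussians add. Read from left to right, this takes one Gaussian
  summand of scale \<open>t\<close> out of the smoothing, ready to be exchanged.\<close>

lemma gauss_smooth_semigroup:
  fixes h :: "real^'n \<Rightarrow> real"
  assumes lip: "\<And>x y. \<bar>h x - h y\<bar> \<le> dist x y" and "0 \<le> s" "0 < t" "0 \<le> r" "r\<^sup>2 = s\<^sup>2 + t\<^sup>2"
  shows "gauss_smooth r h x = (\<integral>z. gauss_smooth s h (x + t *\<^sub>R z) \<partial>std_gaussian)"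
proof (cases "s = 0")
  case True
  then have "r = t"
    using assms by (simp add: power2_eq_iff_nonneg)
  then show ?thesis
    using True by (simp add: gauss_smooth_0) (simp add: gauss_smooth_def)
next
  case False
  have r: "r \<noteq> 0"
    using assms by (smt (verit) zero_less_power2 zero_le_power2 power2_eq_square mult_zero_left)
  \<comment> \<open>Dividing by the total scale \<open>r\<close> turns the sum into a rotation. The
    rotation identity asks for a positive coefficient, hence the separate case
    \<open>s = 0\<close>.\<close>
  have "(s / r)\<^sup>2 + (t / r)\<^sup>2 = 1" "0 < s / r"
    using assms False r by (simp_all add: power_divide add_divide_distrib [symmetric])
  from integral_std_gaussian_rotate [OF integrable_std_gaussian_lipschitz_affine [OF lip, of x r] this(2) this(1)]
  show ?thesis
    using r by (simp add: gauss_smooth_def scaleR_add_right add.assoc)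
qed

text \<open>Exhibits the second-order term as a quadratic form in \<open>w\<close> with coefficients
  free of \<open>w\<close>, so that averaging over \<open>w\<close> involves only second moments of
  its law.\<close>

lemma gaussian_second_order_form:
  fixes g :: "real^'n \<Rightarrow> real" and w :: "real^'n"
  assumes int: "\<And>j k. integrable std_gaussian (\<lambda>y. g y * (y $ j * y $ k - (if j = k then 1 else 0)))"
  shows "(\<integral>y. g y * ((y \<bullet> w)\<^sup>2 - (norm w)\<^sup>2) \<partial>std_gaussian)
    = (\<Sum>j\<in>UNIV. \<Sum>k\<in>UNIV. w $ j * w $ k * (\<integral>y. g y * (y $ j * y $ k - (if j = k then 1 else 0)) \<partial>std_gaussian))"
proof -
  have "g y * ((y \<bullet> w)\<^sup>2 - (norm w)\<^sup>2)
      = (\<Sum>j\<in>UNIV. \<Sum>k\<in>UNIV. w $ j * w $ k * (g y * (y $ j * y $ k - (if j = k then 1 else 0))))" for y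
  proof -
    have 1: "(y \<bullet> w)\<^sup>2 = (\<Sum>j\<in>UNIV. \<Sum>k\<in>UNIV. w $ j * w $ k * (y $ j * y $ k))"
      by (simp add: inner_vec_def power2_eq_square sum_product mult_ac)
    have 2: "(norm w)\<^sup>2 = (\<Sum>j\<in>UNIV. \<Sum>k\<in>UNIV. w $ j * w $ k * (if j = k then 1 else 0))"
      by (simp add: power2_norm_eq_inner inner_vec_def if_distrib [of "\<lambda>x. _ * x"] cong: if_cong)
    show ?thesis
      unfolding 1 2 sum_subtractf [symmetric] sum_distrib_left
      by (intro sum.cong refl) (simp add: algebra_simps)
  qed
  then show ?thesis
    using int by simp
qed

lemma gaussian_first_order_form:
  fixes g :: "real^'n \<Rightarrow> real" and w :: "real^'n"
  assumes int: "\<And>j. integrable std_gaussian (\<lambda>y. g y * y $ j)"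
  shows "(\<integral>y. g y * (y \<bullet> w) \<partial>std_gaussian) = (\<Sum>j\<in>UNIV. w $ j * (\<integral>y. g y * y $ j \<partial>std_gaussian))"
proof -
  have "g y * (y \<bullet> w) = (\<Sum>j\<in>UNIV. w $ j * (g y * y $ j))" for y
    by (simp add: inner_vec_def sum_distrib_left mult_ac)
  then show ?thesis
    using int by simp
qed

text \<open>Only the third-order remainder depends on the law \<open>\<mu>\<close>: the lower-order terms see it through its mean and
  covariance.\<close>

lemma (in isotropic_law) gauss_smooth_expansion:
  fixes h :: "real^'n \<Rightarrow> real"
  assumes lip: "\<And>x y. \<bar>h x - h y\<bar> \<le> dist x y" and s: "0 < s" and \<tau>: "0 \<le> \<tau>"
  shows "\<bar>(\<integral>z. gauss_smooth s h (x + \<tau> *\<^sub>R z) \<partial>\<mu>) - gauss_smooth s h x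
      - 1/2 * (\<tau> / s)\<^sup>2 * (\<Sum>j\<in>UNIV. \<integral>y. h (x + s *\<^sub>R y) * (y $ j * y $ j - 1) \<partial>std_gaussian)\<bar>
    \<le> \<tau> ^ 3 / (6 * s\<^sup>2) * (\<integral>z. norm z ^ 3 \<partial>\<mu>)"
proof -
  \<comment> \<open>Absorbing the base point and the scale into \<open>g\<close> leaves an average
    over the standard Gaussian, at the price of Lipschitz constant \<open>s\<close>.\<close>
  define g where "g y = h (x + s *\<^sub>R y)" for y
  have g_lip: "\<bar>g y - g z\<bar> \<le> s * dist y z" for y z
    using lip [of "x + s *\<^sub>R y" "x + s *\<^sub>R z"] s by (simp add: g_def dist_norm flip: scaleR_diff_right)
  note gm [measurable] = lipschitz_borel_measurable [OF g_lip]
  define A where "A = \<bar>g 0\<bar> + s"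
  have g_le: "\<bar>g y\<bar> \<le> A * (1 + norm y)" for y
    unfolding A_def using s by (intro lipschitz_linear_growth [OF g_lip]) simp
  have A: "0 \<le> A"
    using s by (simp add: A_def)
  have comp_le: "\<bar>y $ j\<bar> \<le> 1 + norm y" for y :: "real^'n" and j
    using component_le_norm_cart [of y j] by linarith
  have int1: "integrable std_gaussian (\<lambda>y. g y * y $ j)" for j
  proof (rule integrable_std_gaussian_polynomial_growth [where k = 2 and C = A])
    fix y
    have "\<bar>g y * y $ j\<bar> \<le> A * (1 + norm y) * (1 + norm y)"
      using A unfolding abs_mult by (intro mult_mono g_le comp_le) auto
    then show "\<bar>g y * y $ j\<bar> \<le> A * (1 + norm y)\<^sup>2"
      by (simp add: power2_eq_square mult_ac)
  qed measurable
  have int2: "integrable std_gaussian (\<lambda>y. g y * (y $ j * y $ k - (if j = k then 1 else 0)))" for j k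
  proof (rule integrable_std_gaussian_polynomial_growth [where k = 3 and C = "2 * A"])
    fix y :: "real^'n"
    have "\<bar>y $ j * y $ k\<bar> \<le> (1 + norm y) * (1 + norm y)"
      unfolding abs_mult by (intro mult_mono comp_le) auto
    moreover have "1 * 1 \<le> (1 + norm y) * (1 + norm y)"
      by (intro mult_mono) auto
    moreover have "\<bar>v - (if b then 1 else 0)\<bar> \<le> 2 * c" if "\<bar>v\<bar> \<le> c" "1 * 1 \<le> c" for v c :: real and b
      using that by (cases b) auto
    ultimately have "\<bar>y $ j * y $ k - (if j = k then 1 else 0)\<bar> \<le> 2 * ((1 + norm y) * (1 + norm y))"
      by blast
    then have "\<bar>g y * (y $ j * y $ k - (if j = k then 1 else 0))\<bar>
        \<le> A * (1 + norm y) * (2 * ((1 + norm y) * (1 + norm y)))"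
      using A unfolding abs_mult by (intro mult_mono g_le) auto
    also have "\<dots> = 2 * A * (1 + norm y) ^ 3"
      by (simp add: power3_eq_cube mult_ac)
    finally show "\<bar>g y * (y $ j * y $ k - (if j = k then 1 else 0))\<bar> \<le> 2 * A * (1 + norm y) ^ 3" .
  qed measurable
  define a where "a j = (\<integral>y. g y * y $ j \<partial>std_gaussian)" for j
  define B where "B j k = (\<integral>y. g y * (y $ j * y $ k - (if j = k then 1 else 0)) \<partial>std_gaussian)" for j k
  \<comment> \<open>Moving the argument of \<open>h\<close> by \<open>\<tau> *\<^sub>R z\<close> is
    the same as moving the Gaussian variable by \<open>c *\<^sub>R z\<close>.\<close>
  define c where "c = \<tau> / s"
  define L where "L z = c * (\<Sum>j\<in>UNIV. z $ j * a j)" for z :: "real^'n"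
  define Q where "Q z = c\<^sup>2 * (\<Sum>j\<in>UNIV. \<Sum>k\<in>UNIV. z $ j * z $ k * B j k)" for z :: "real^'n"
  have L: "integrable \<mu> L" "(\<integral>z. L z \<partial>\<mu>) = 0"
    unfolding L_def by (simp_all add: integrable_components mean_zero)
  have Q: "integrable \<mu> Q" "(\<integral>z. Q z \<partial>\<mu>) = c\<^sup>2 * (\<Sum>j\<in>UNIV. B j j)"
    unfolding Q_def by (simp_all add: integrable_components covariance if_distrib [of "\<lambda>x. x * _"] cong: if_cong)
  let ?f = "gauss_smooth s h"
  have f: "integrable \<mu> (\<lambda>z. ?f (x + \<tau> *\<^sub>R z))"
  proof (rule integrable_lipschitz)
    fix y z
    show "\<bar>?f (x + \<tau> *\<^sub>R y) - ?f (x + \<tau> *\<^sub>R z)\<bar> \<le> \<tau> * dist y z"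
      using gauss_smooth_lipschitz [OF lip, of s "x + \<tau> *\<^sub>R y" "x + \<tau> *\<^sub>R z"] \<tau>
      by (simp add: dist_norm flip: scaleR_diff_right)
  qed
  have R: "\<bar>?f (x + \<tau> *\<^sub>R z) - ?f x - L z - 1/2 * Q z\<bar> \<le> \<tau> ^ 3 / (6 * s\<^sup>2) * norm z ^ 3" for z
  proof -
    let ?w = "c *\<^sub>R z"
    have c: "0 \<le> c" "s * c = \<tau>"
      using s \<tau> by (simp_all add: c_def)
    have "g (y + ?w) = h (x + \<tau> *\<^sub>R z + s *\<^sub>R y)" for y
      using c by (simp add: g_def scaleR_add_right algebra_simps)
    then have "?f (x + \<tau> *\<^sub>R z) = (\<integral>y. g (y + ?w) \<partial>std_gaussian)" "?f x = (\<integral>y. g y \<partial>std_gaussian)"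
      by (simp_all add: gauss_smooth_def g_def)
    moreover have "L z = (\<integral>y. g y * (y \<bullet> ?w) \<partial>std_gaussian)"
      by (subst gaussian_first_order_form [OF int1]) (simp add: L_def a_def sum_distrib_left mult_ac)
    moreover have "Q z = (\<integral>y. g y * ((y \<bullet> ?w)\<^sup>2 - (norm ?w)\<^sup>2) \<partial>std_gaussian)"
      unfolding Q_def B_def
      by (subst gaussian_second_order_form [OF int2]) (simp add: sum_distrib_left power2_eq_square mult_ac)
    ultimately have "\<bar>?f (x + \<tau> *\<^sub>R z) - ?f x - L z - 1/2 * Q z\<bar>
        \<le> s * norm ?w / 6 * (\<integral>y. \<bar>(y \<bullet> ?w)\<^sup>2 - (norm ?w)\<^sup>2\<bar> \<partial>std_gaussian)"
      using std_gaussian_taylor [OF g_lip, of ?w] s by simp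
    also have "\<dots> \<le> s * norm ?w / 6 * (norm ?w)\<^sup>2"
      using s by (intro mult_left_mono integral_abs_gaussian_hermite2_le) simp
    \<comment> \<open>One factor \<open>s\<close> from the Lipschitz constant meets three factors
      \<open>1 / s\<close> from \<open>c\<close>, leaving the inverse square of the smoothing
      scale.\<close>
    also have "\<dots> = \<tau> ^ 3 / (6 * s\<^sup>2) * norm z ^ 3"
      using s \<tau> by (simp add: c_def power2_eq_square power3_eq_cube field_simps)
    finally show ?thesis .
  qed
  have "(\<integral>z. ?f (x + \<tau> *\<^sub>R z) \<partial>\<mu>) - ?f x - 1/2 * c\<^sup>2 * (\<Sum>j\<in>UNIV. B j j)
      = (\<integral>z. ?f (x + \<tau> *\<^sub>R z) - ?f x - L z - 1/2 * Q z \<partial>\<mu>)"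
    using f L Q by (simp add: prob_space [simplified])
  also have "\<bar>\<dots>\<bar> \<le> (\<integral>z. \<tau> ^ 3 / (6 * s\<^sup>2) * norm z ^ 3 \<partial>\<mu>)"
  proof (rule order_trans [OF integral_abs_bound], rule integral_mono)
    show "integrable \<mu> (\<lambda>z. \<bar>?f (x + \<tau> *\<^sub>R z) - ?f x - L z - 1/2 * Q z\<bar>)"
      using f L Q by simp
    show "integrable \<mu> (\<lambda>z. \<tau> ^ 3 / (6 * s\<^sup>2) * norm z ^ 3)"
      using third_moment by (rule integrable_mult_right)
  qed (rule R)
  finally show ?thesis
    by (simp add: B_def g_def c_def)
qed

text \<open>The expansions for \<open>\<mu>\<close> and for the Gaussian share their value and
  second-order terms, so only the two remainders are left after subtraction.\<close>

lemma (in isotropic_law) gauss_smooth_exchange: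
  fixes h :: "real^'n \<Rightarrow> real"
  assumes lip: "\<And>x y. \<bar>h x - h y\<bar> \<le> dist x y" and s: "0 < s" and \<tau>: "0 \<le> \<tau>"
  shows "\<bar>(\<integral>z. gauss_smooth s h (x + \<tau> *\<^sub>R z) \<partial>std_gaussian) - (\<integral>z. gauss_smooth s h (x + \<tau> *\<^sub>R z) \<partial>\<mu>)\<bar>
    \<le> \<tau> ^ 3 / (6 * s\<^sup>2) * ((\<integral>z. norm (z::real^'n) ^ 3 \<partial>std_gaussian) + (\<integral>z. norm z ^ 3 \<partial>\<mu>))"
  using gauss_smooth_expansion [OF assms, of x]
    isotropic_law.gauss_smooth_expansion [OF isotropic_law_std_gaussian assms, of x]
  unfolding distrib_left by linarith

text \<open>Both averages are compared with \<open>h x\<close>. This serves the final exchange,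
  where no Gaussian is left to smooth \<open>h\<close>.\<close>

lemma (in isotropic_law) lipschitz_exchange:
  fixes h :: "real^'n \<Rightarrow> real"
  assumes lip: "\<And>x y. \<bar>h x - h y\<bar> \<le> dist x y" and \<tau>: "0 \<le> \<tau>"
  shows "\<bar>(\<integral>z. h (x + \<tau> *\<^sub>R z) \<partial>std_gaussian) - (\<integral>z. h (x + \<tau> *\<^sub>R z) \<partial>\<mu>)\<bar>
    \<le> \<tau> * ((\<integral>z. norm (z::real^'n) \<partial>std_gaussian) + (\<integral>z. norm z \<partial>\<mu>))"
proof -
  have bound: "\<bar>(\<integral>z. h (x + \<tau> *\<^sub>R z) \<partial>\<nu>) - h x\<bar> \<le> \<tau> * (\<integral>z. norm z \<partial>\<nu>)"
    if "isotropic_law \<nu>" for \<nu> :: "(real^'n) measure"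
  proof -
    interpret \<nu>: isotropic_law \<nu> by fact
    have int: "integrable \<nu> (\<lambda>z. h (x + \<tau> *\<^sub>R z))"
    proof (rule \<nu>.integrable_lipschitz)
      fix y z
      show "\<bar>h (x + \<tau> *\<^sub>R y) - h (x + \<tau> *\<^sub>R z)\<bar> \<le> \<tau> * dist y z"
        using lip [of "x + \<tau> *\<^sub>R y" "x + \<tau> *\<^sub>R z"] \<tau> by (simp add: dist_norm flip: scaleR_diff_right)
    qed
    have "(\<integral>z. h (x + \<tau> *\<^sub>R z) \<partial>\<nu>) - h x = (\<integral>z. h (x + \<tau> *\<^sub>R z) - h x \<partial>\<nu>)"
      using int by (simp add: \<nu>.prob_space [simplified])
    also have "\<bar>\<dots>\<bar> \<le> (\<integral>z. \<tau> * norm z \<partial>\<nu>)"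
    proof (rule order_trans [OF integral_abs_bound], rule integral_mono)
      fix z
      show "\<bar>h (x + \<tau> *\<^sub>R z) - h x\<bar> \<le> \<tau> * norm z"
        using lip [of "x + \<tau> *\<^sub>R z" x] \<tau> by (simp add: dist_norm)
    qed (use int \<nu>.integrable_components(3) in simp_all)
    finally show ?thesis by simp
  qed
  show ?thesis
    using bound [OF isotropic_law_std_gaussian] bound [OF isotropic_law_axioms] unfolding distrib_left by linarith
qed

section \<open>Lindeberg replacement\<close>

text \<open>Independence makes the joint law a product, so Fubini allows freezing \<open>X\<close>
  and averaging over \<open>Y\<close> alone; pointwise exchange bounds then apply with
  \<open>X\<close> as base point.\<close>

lemma (in prob_space) indep_var_integral_iterated:
  fixes g :: "'b \<times> 'b \<Rightarrow> real"
  assumes ind: "indep_var S X T Y" and g: "g \<in> borel_measurable (S \<Otimes>\<^sub>M T)"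
    and int: "integrable M (\<lambda>\<omega>. g (X \<omega>, Y \<omega>))"
  shows "integrable M (\<lambda>\<omega>. \<integral>z. g (X \<omega>, z) \<partial>distr M T Y)"
    and "expectation (\<lambda>\<omega>. g (X \<omega>, Y \<omega>)) = expectation (\<lambda>\<omega>. \<integral>z. g (X \<omega>, z) \<partial>distr M T Y)"
proof -
  have XY [measurable]: "random_variable S X" "random_variable T Y"
    and eq: "distr M S X \<Otimes>\<^sub>M distr M T Y = distr M (S \<Otimes>\<^sub>M T) (\<lambda>\<omega>. (X \<omega>, Y \<omega>))"
    using ind unfolding indep_var_distribution_eq by auto
  note g [measurable]
  interpret X: prob_space "distr M S X" by (rule prob_space_distr) fact
  interpret Y: prob_space "distr M T Y" by (rule prob_space_distr) fact
  interpret XY: pair_sigma_finite "distr M S X" "distr M T Y" ..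
  have i: "integrable (distr M S X \<Otimes>\<^sub>M distr M T Y) g"
    unfolding eq using int by (subst integrable_distr_eq) simp_all
  have m: "(\<lambda>x. \<integral>z. g (x, z) \<partial>distr M T Y) \<in> borel_measurable S"
    by measurable
  show "integrable M (\<lambda>\<omega>. \<integral>z. g (X \<omega>, z) \<partial>distr M T Y)"
    using XY.integrable_fst' [OF i] m by (subst (asm) integrable_distr_eq) simp_all
  have "expectation (\<lambda>\<omega>. g (X \<omega>, Y \<omega>)) = integral\<^sup>L (distr M S X \<Otimes>\<^sub>M distr M T Y) g"
    unfolding eq by (subst integral_distr) simp_all
  also have "\<dots> = (\<integral>x. (\<integral>z. g (x, z) \<partial>distr M T Y) \<partial>distr M S X)"
    by (rule XY.integral_fst' [OF i, symmetric])
  also have "\<dots> = expectation (\<lambda>\<omega>. \<integral>z. g (X \<omega>, z) \<partial>distr M T Y)"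
    using m by (subst integral_distr) simp_all
  finally show "expectation (\<lambda>\<omega>. g (X \<omega>, Y \<omega>)) = expectation (\<lambda>\<omega>. \<integral>z. g (X \<omega>, z) \<partial>distr M T Y)" .
qed

text \<open>The two variables are functions of disjoint blocks of the independent family.\<close>

lemma (in prob_space) indep_var_partial_sum:
  fixes \<xi> :: "nat \<Rightarrow> 'a \<Rightarrow> 'b::{second_countable_topology, real_normed_vector}"
  assumes "indep_vars (\<lambda>_. borel) \<xi> UNIV"
  shows "indep_var borel (\<lambda>\<omega>. \<Sum>i\<in>{1..k}. \<xi> i \<omega>) borel (\<xi> (Suc k))"
proof -
  have "indep_var
    borel ((\<lambda>f. \<Sum>i\<in>{1..k}. f i) \<circ> (\<lambda>\<omega>. restrict (\<lambda>i. \<xi> i \<omega>) {1..k}))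
    borel ((\<lambda>f. f (Suc k)) \<circ> (\<lambda>\<omega>. restrict (\<lambda>i. \<xi> i \<omega>) {Suc k}))"
    by (intro indep_var_compose [OF indep_var_restrict [OF assms]]) auto
  then show ?thesis
    by (simp add: comp_def)
qed

lemma (in prob_space) integrable_lipschitz_comp:
  fixes f :: "real^'n \<Rightarrow> real"
  assumes lip: "\<And>x y. \<bar>f x - f y\<bar> \<le> dist x y" and X: "integrable M X"
  shows "integrable M (\<lambda>\<omega>. f (X \<omega>))"
proof -
  have [measurable]: "f \<in> borel_measurable borel"
    by (rule lipschitz_borel_measurable [where K = 1]) (simp add: lip)
  have "integrable M (\<lambda>\<omega>. f (X \<omega>) - f 0)"
    using X lip [of _ 0] by (intro Bochner_Integration.integrable_bound [OF integrable_norm [OF X]]) auto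
  from Bochner_Integration.integrable_add [OF this integrable_const [of "f 0"]] show ?thesis
    by simp
qed

text \<open>The harmonic number minus the logarithm decreases from its initial value 1. The shift to
  \<open>Suc m\<close> fits \<open>n = Suc m\<close> summands, of which \<open>m\<close> are
  exchanged under smoothing.\<close>

lemma harm_le_one_plus_ln: "harm m \<le> 1 + ln (real (Suc m))"
proof (cases m)
  case 0
  then show ?thesis by (simp add: harm_def)
next
  case (Suc k)
  have "harm (Suc k) - ln (real (Suc k)) \<le> 1"
    using decseqD [OF decseq_harm_diff_ln, of 0 k] by (simp add: harm_expand)
  moreover have "ln (real (Suc k)) \<le> ln (real (Suc (Suc k)))"
    by simp
  ultimately show ?thesis
    unfolding Suc by linarith
qed

lemma (in prob_space) lindeberg_lipschitz_bound:
  fixes \<xi> :: "nat \<Rightarrow> 'a \<Rightarrow> real^'n" and h :: "real^'n \<Rightarrow> real"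
  assumes indep: "indep_vars (\<lambda>_. borel) \<xi> UNIV" and law: "\<And>i. distr M borel (\<xi> i) = \<mu>"
    and iso: "isotropic_law \<mu>" and lip: "\<And>x y. \<bar>h x - h y\<bar> \<le> dist x y"
  shows "\<bar>(\<integral>x. h x \<partial>std_gaussian) - expectation (\<lambda>\<omega>. h ((1 / sqrt (real (Suc m))) *\<^sub>R (\<Sum>i\<in>{1..Suc m}. \<xi> i \<omega>)))\<bar>
    \<le> 1 / sqrt (real (Suc m)) *
      (harm m / 6 * ((\<integral>z. norm (z::real^'n) ^ 3 \<partial>std_gaussian) + (\<integral>z. norm z ^ 3 \<partial>\<mu>))
        + ((\<integral>z. norm (z::real^'n) \<partial>std_gaussian) + (\<integral>z. norm z \<partial>\<mu>)))"
proof -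
  interpret \<mu>: isotropic_law \<mu> by fact
  define \<tau> where "\<tau> = 1 / sqrt (real (Suc m))"
  \<comment> \<open>In the \<open>k\<close>-th hybrid the first \<open>k\<close> summands are
    \<open>\<xi>\<close> and the other \<open>Suc m - k\<close> are Gaussian;
    \<open>\<sigma> k\<close> is the joint scale of the latter, which enter \<open>a k\<close> only
    through the smoothing.\<close>
  define \<sigma> where "\<sigma> k = \<tau> * sqrt (real (Suc m - k))" for k
  define S where "S k \<omega> = (\<Sum>i\<in>{1..k}. \<xi> i \<omega>)" for k \<omega>
  define a where "a k = expectation (\<lambda>\<omega>. gauss_smooth (\<sigma> k) h (\<tau> *\<^sub>R S k \<omega>))" for k
  let ?M3 = "(\<integral>z. norm (z::real^'n) ^ 3 \<partial>std_gaussian) + (\<integral>z. norm z ^ 3 \<partial>\<mu>)"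
  let ?M1 = "(\<integral>z. norm (z::real^'n) \<partial>std_gaussian) + (\<integral>z. norm z \<partial>\<mu>)"
  have \<tau>: "0 < \<tau>" "\<tau>\<^sup>2 = 1 / real (Suc m)"
    by (simp_all add: \<tau>_def power_divide)
  have \<sigma>_sq: "(\<sigma> k)\<^sup>2 = \<tau>\<^sup>2 * real (Suc m - k)" for k
    by (simp add: \<sigma>_def power_mult_distrib)
  have \<sigma>_nonneg: "0 \<le> \<sigma> k" for k
    using \<tau> by (simp add: \<sigma>_def)
  have [measurable]: "random_variable borel (\<xi> i)" for i
    using indep by (simp add: indep_vars_def)
  have \<xi>_int: "integrable M (\<xi> i)" for i
  proof -
    have "integrable M (\<lambda>\<omega>. norm (\<xi> i \<omega>))"
      using \<mu>.integrable_components(3) unfolding law [of i, symmetric] by (subst (asm) integrable_distr_eq) simp_all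
    then show ?thesis
      by (rule integrable_norm_cancel) simp
  qed
  have S_int: "integrable M (\<lambda>\<omega>. \<tau> *\<^sub>R S k \<omega>)" for k
    unfolding S_def using \<xi>_int by simp
  have S_meas [measurable]: "random_variable borel (S k)" for k
    unfolding S_def by measurable
  note smooth_lip = gauss_smooth_lipschitz [OF lip]
  have smooth_meas [measurable]: "gauss_smooth s h \<in> borel_measurable borel" for s
    by (rule lipschitz_borel_measurable [where K = 1]) (simp add: smooth_lip)
  \<comment> \<open>The pointwise bound \<open>e\<close> is kept abstract so that the smoothed
    exchanges and the unsmoothed last one share the same reduction.\<close>
  have step: "\<bar>a k - a (Suc k)\<bar> \<le> e"
    if k: "k \<le> m" and e: "\<And>x. \<bar>(\<integral>z. gauss_smooth (\<sigma> (Suc k)) h (x + \<tau> *\<^sub>R z) \<partial>std_gaussian)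
        - (\<integral>z. gauss_smooth (\<sigma> (Suc k)) h (x + \<tau> *\<^sub>R z) \<partial>\<mu>)\<bar> \<le> e" for k e
  proof -
    let ?f = "gauss_smooth (\<sigma> (Suc k)) h"
    let ?F = "\<lambda>\<omega>. gauss_smooth (\<sigma> k) h (\<tau> *\<^sub>R S k \<omega>)"
    let ?G = "\<lambda>\<omega>. \<integral>z. ?f (\<tau> *\<^sub>R S k \<omega> + \<tau> *\<^sub>R z) \<partial>\<mu>"
    have F: "integrable M ?F"
      by (rule integrable_lipschitz_comp [OF smooth_lip S_int])
    have Suc_eq: "?f (\<tau> *\<^sub>R S (Suc k) \<omega>) = ?f (\<tau> *\<^sub>R S k \<omega> + \<tau> *\<^sub>R \<xi> (Suc k) \<omega>)" for \<omega>
      by (simp add: S_def scaleR_add_right)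
    have "integrable M (\<lambda>\<omega>. ?f (\<tau> *\<^sub>R S (Suc k) \<omega>))"
      by (rule integrable_lipschitz_comp [OF smooth_lip S_int])
    then have int: "integrable M (\<lambda>\<omega>. ?f (\<tau> *\<^sub>R S k \<omega> + \<tau> *\<^sub>R \<xi> (Suc k) \<omega>))"
      unfolding Suc_eq .
    note iter = indep_var_integral_iterated [OF indep_var_partial_sum [OF indep, of k],
        of "\<lambda>p. ?f (\<tau> *\<^sub>R fst p + \<tau> *\<^sub>R snd p)", folded S_def, unfolded law fst_conv snd_conv, OF _ int]
    have G: "integrable M ?G" "a (Suc k) = expectation ?G"
      using iter unfolding a_def Suc_eq by simp_all
    have "\<bar>?F \<omega> - ?G \<omega>\<bar> \<le> e" for \<omega>
    proof -
      \<comment> \<open>One Gaussian of scale \<open>\<tau>\<close> is split off, in the slot that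
        \<open>\<xi> (Suc k)\<close> takes in the next hybrid.\<close>
      have "(\<sigma> k)\<^sup>2 = (\<sigma> (Suc k))\<^sup>2 + \<tau>\<^sup>2"
        using k unfolding \<sigma>_sq by (simp add: of_nat_diff algebra_simps)
      then have "?F \<omega> = (\<integral>z. ?f (\<tau> *\<^sub>R S k \<omega> + \<tau> *\<^sub>R z) \<partial>std_gaussian)"
        by (intro gauss_smooth_semigroup lip \<sigma>_nonneg \<tau>(1))
      then show ?thesis
        using e by simp
    qed
    then have le: "expectation (\<lambda>\<omega>. \<bar>?F \<omega> - ?G \<omega>\<bar>) \<le> expectation (\<lambda>_. e)"
      using F G by (intro integral_mono) auto
    have "a k - a (Suc k) = expectation (\<lambda>\<omega>. ?F \<omega> - ?G \<omega>)"
      using F G by (simp add: a_def)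
    also have "\<bar>\<dots>\<bar> \<le> expectation (\<lambda>\<omega>. \<bar>?F \<omega> - ?G \<omega>\<bar>)"
      by (rule integral_abs_bound)
    also note le
    finally show ?thesis
      by (simp add: prob_space)
  qed
  have early: "\<bar>a k - a (Suc k)\<bar> \<le> \<tau> * (?M3 / 6) * inverse (real (Suc (m - Suc k)))" if k: "k < m" for k
  proof -
    have mk: "real (Suc m - Suc k) = real (Suc (m - Suc k))"
      using k by simp
    have pos: "0 < \<sigma> (Suc k)"
      using k \<tau> by (simp add: \<sigma>_def)
    \<comment> \<open>The squared scale is \<open>\<tau>^2\<close> times the number of Gaussians
      still present, so two powers of \<open>\<tau>\<close> cancel.\<close>
    have "\<tau> ^ 3 / (6 * (\<sigma> (Suc k))\<^sup>2) = \<tau> / 6 * inverse (real (Suc (m - Suc k)))"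
      unfolding \<sigma>_sq mk using \<tau>(1)
      by (simp add: power3_eq_cube power2_eq_square inverse_eq_divide del: of_nat_Suc)
    moreover have "\<bar>a k - a (Suc k)\<bar> \<le> \<tau> ^ 3 / (6 * (\<sigma> (Suc k))\<^sup>2) * ?M3"
      using k \<tau>(1) by (intro step \<mu>.gauss_smooth_exchange lip pos) auto
    ultimately show ?thesis
      by (simp only: mult_ac times_divide_eq_left times_divide_eq_right)
  qed
  have last: "\<bar>a m - a (Suc m)\<bar> \<le> \<tau> * ?M1"
    using \<tau>(1) \<mu>.lipschitz_exchange [OF lip, of \<tau>]
    by (intro step) (simp_all add: \<sigma>_def gauss_smooth_0)
  have "a 0 - a (Suc m) = (\<Sum>k<Suc m. a k - a (Suc k))"
    by (rule sum_lessThan_telescope' [symmetric])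
  also have "\<bar>\<dots>\<bar> \<le> (\<Sum>k<m. \<bar>a k - a (Suc k)\<bar>) + \<bar>a m - a (Suc m)\<bar>"
    using sum_abs [of "\<lambda>k. a k - a (Suc k)" "{..<Suc m}"] by simp
  also have "\<dots> \<le> (\<Sum>k<m. \<tau> * (?M3 / 6) * inverse (real (Suc (m - Suc k)))) + \<tau> * ?M1"
    by (intro add_mono sum_mono early last) simp
  \<comment> \<open>Reversing the order of summation turns the reciprocals of the numbers of
    remaining Gaussians into the harmonic number.\<close>
  also have "(\<Sum>k<m. \<tau> * (?M3 / 6) * inverse (real (Suc (m - Suc k)))) = \<tau> * (?M3 / 6) * harm m"
    unfolding sum_distrib_left [symmetric] harm_altdef
    by (subst sum.nat_diff_reindex [of "\<lambda>i. inverse (real (Suc i))"]) simp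
  finally have main: "\<bar>a 0 - a (Suc m)\<bar> \<le> \<tau> * (?M3 / 6) * harm m + \<tau> * ?M1" .
  \<comment> \<open>The ends of the telescope: full smoothing of an empty sum at index 0, and no
    smoothing of the complete sum at index \<open>Suc m\<close>.\<close>
  have "\<sigma> 0 = 1"
    by (simp add: \<sigma>_def \<tau>_def)
  then have "a 0 = (\<integral>x. h x \<partial>std_gaussian)"
    by (simp add: a_def S_def gauss_smooth_def prob_space)
  moreover have "a (Suc m) = expectation (\<lambda>\<omega>. h (\<tau> *\<^sub>R S (Suc m) \<omega>))"
    by (simp add: a_def \<sigma>_def gauss_smooth_0)
  ultimately show ?thesis
    using main by (simp only: S_def [symmetric] \<tau>_def [symmetric]) (simp add: algebra_simps add_divide_distrib)
qed

lemma (in prob_space) isotropic_law_distr: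
  fixes X :: "'a \<Rightarrow> real^'n"
  assumes X [measurable]: "X \<in> borel_measurable M"
    and mean: "integrable M X" "expectation X = 0"
    and cov: "\<And>j k. expectation (\<lambda>\<omega>. X \<omega> $ j * X \<omega> $ k) = (if j = k then 1 else 0)"
    and third: "(\<integral>\<^sup>+\<omega>. ennreal (norm (X \<omega>) ^ 3) \<partial>M) < \<infinity>"
  shows "isotropic_law (distr M borel X)"
proof -
  interpret D: prob_space "distr M borel X"
    by (rule prob_space_distr) simp
  show ?thesis
  proof
    show "integrable (distr M borel X) (\<lambda>z. norm z ^ 3)"
      using third by (simp add: integrable_iff_bounded nn_integral_distr)
    fix j k
    show "(\<integral>z. z $ j \<partial>distr M borel X) = 0"
      using integral_bounded_linear [OF bounded_linear_vec_nth mean(1), of j] mean(2)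
      by (simp add: integral_distr)
    show "(\<integral>z. z $ j * z $ k \<partial>distr M borel X) = (if j = k then 1 else 0)"
      by (subst integral_distr) (simp_all add: cov)
  qed simp
qed

section \<open>Moment inequalities and comparison of the constants\<close>

lemma (in isotropic_law) second_moment:
  "integrable \<mu> (\<lambda>z. (norm z)\<^sup>2)" "(\<integral>z. (norm z)\<^sup>2 \<partial>\<mu>) = real CARD('n)"
proof -
  have "(norm z)\<^sup>2 = (\<Sum>j\<in>UNIV. z $ j * z $ j)" for z :: "real^'n"
    by (simp add: power2_norm_eq_inner inner_vec_def)
  then show "integrable \<mu> (\<lambda>z. (norm z)\<^sup>2)" "(\<integral>z. (norm z)\<^sup>2 \<partial>\<mu>) = real CARD('n)"
    by (simp_all add: integrable_components covariance)
qed

text \<open>Integrate the inequality between arithmetic and geometric means, weighted to be an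
  equality at norm \<open>x = sqrt d\<close>.\<close>

lemma (in isotropic_law) first_moment_le: "(\<integral>z. norm z \<partial>\<mu>) \<le> sqrt (real CARD('n))"
proof -
  define x where "x = sqrt (real CARD('n))"
  have x: "0 < x" "x\<^sup>2 = real CARD('n)"
    by (simp_all add: x_def)
  have "(\<integral>z. norm z \<partial>\<mu>) \<le> (\<integral>z. (norm z)\<^sup>2 / (2 * x) + x / 2 \<partial>\<mu>)"
  proof (rule integral_mono)
    fix z
    have "0 \<le> (norm z - x)\<^sup>2 / (2 * x)"
      using x by simp
    then show "norm z \<le> (norm z)\<^sup>2 / (2 * x) + x / 2"
      using x by (simp add: power2_eq_square field_simps)
  qed (use second_moment integrable_components(3) in simp_all)
  also have "\<dots> = x\<^sup>2 / (2 * x) + x / 2"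
    using second_moment by (simp add: x(2) prob_space [simplified])
  also have "\<dots> = x"
    using x(1) by (simp add: power2_eq_square field_simps)
  finally show ?thesis
    by (simp add: x_def)
qed

text \<open>The cube is bounded below by the affine function of the square that touches it at
  \<open>x = sqrt d\<close>; the gap factors as
  \<open>(norm z - x)^2 * (norm z + x / 2)\<close>.\<close>

lemma (in isotropic_law) third_moment_ge: "sqrt (real CARD('n)) ^ 3 \<le> (\<integral>z. norm z ^ 3 \<partial>\<mu>)"
proof -
  define x where "x = sqrt (real CARD('n))"
  have x: "0 < x" "x\<^sup>2 = real CARD('n)"
    by (simp_all add: x_def)
  have "x ^ 3 = 3 / 2 * x * x\<^sup>2 - x ^ 3 / 2"
    by (simp add: power2_eq_square power3_eq_cube)
  also have "\<dots> = (\<integral>z. 3 / 2 * x * (norm z)\<^sup>2 - x ^ 3 / 2 \<partial>\<mu>)"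
    using second_moment by (simp add: x(2) prob_space [simplified])
  also have "\<dots> \<le> (\<integral>z. norm z ^ 3 \<partial>\<mu>)"
  proof (rule integral_mono)
    fix z
    have "0 \<le> (norm z - x)\<^sup>2 * (norm z + x / 2)"
      using x by simp
    then show "3 / 2 * x * (norm z)\<^sup>2 - x ^ 3 / 2 \<le> norm z ^ 3"
      by (simp add: power2_eq_square power3_eq_cube algebra_simps)
  qed (use second_moment third_moment in simp_all)
  finally show ?thesis
    by (simp add: x_def)
qed

text \<open>\<open>\<beta>\<close> takes the place of the Gaussian mean norm in the bound; the work
  beyond the replacement estimate is to fit its constant under this one.\<close>

lemma wasserstein_dist_clt:
  fixes M :: "'a measure" and \<xi> :: "nat \<Rightarrow> 'a \<Rightarrow> real ^ 'n" and n :: nat and \<beta> :: real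
  assumes "prob_space M"
    and meas [measurable]: "\<And>i. \<xi> i \<in> borel_measurable M"
    and indep: "prob_space.indep_vars M (\<lambda>_. borel) \<xi> UNIV"
    and ident: "\<And>i. distr M borel (\<xi> i) = distr M borel (\<xi> 0)"
    and mean: "integrable M (\<xi> 1)" "(\<integral>\<omega>. \<xi> 1 \<omega> \<partial>M) = 0"
    and cov: "\<And>j k. (\<integral>\<omega>. \<xi> 1 \<omega> $ j * \<xi> 1 \<omega> $ k \<partial>M) = (if j = k then 1 else 0)"
    and third: "(\<integral>\<^sup>+ \<omega>. ennreal (norm (\<xi> 1 \<omega>) ^ 3) \<partial>M) < \<infinity>"
    and "n \<ge> 1" and \<beta>: "3 / 4 \<le> \<beta>"
  shows "wasserstein_dist std_gaussian
           (distr M borel (\<lambda>\<omega>. (1 / sqrt (real n)) *\<^sub>R (\<Sum>i\<in>{1..n}. \<xi> i \<omega>)))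
         \<le> ennreal (((2 / 3 * real CARD('n) + 1) * \<beta>
                      + 1 / 3 * (\<integral>\<omega>. norm (\<xi> 1 \<omega>) ^ 3 \<partial>M)
                      + (\<integral>\<omega>. norm (\<xi> 1 \<omega>) \<partial>M))
                     * (1 / sqrt (real n)) * (1 + ln (real n)))"
proof -
  interpret prob_space M by fact
  interpret N: isotropic_law "std_gaussian :: (real^'n) measure"
    by (rule isotropic_law_std_gaussian)
  obtain m where n: "n = Suc m"
    using \<open>n \<ge> 1\<close> by (cases n) auto
  let ?\<mu> = "distr M borel (\<xi> 1)"
  have law: "distr M borel (\<xi> i) = ?\<mu>" for i
    using ident [of i] ident [of 1] by simp
  interpret \<mu>: isotropic_law ?\<mu>
    using mean cov third by (intro isotropic_law_distr) auto
  define E1 E3 B1 B3 where "E1 = (\<integral>\<omega>. norm (\<xi> 1 \<omega>) \<partial>M)" and "E3 = (\<integral>\<omega>. norm (\<xi> 1 \<omega>) ^ 3 \<partial>M)"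
    and "B1 = (\<integral>x. norm (x::real^'n) \<partial>std_gaussian)" and "B3 = (\<integral>x. norm (x::real^'n) ^ 3 \<partial>std_gaussian)"
  have law_moments: "(\<integral>z. norm z \<partial>?\<mu>) = E1" "(\<integral>z. norm z ^ 3 \<partial>?\<mu>) = E3"
    unfolding E1_def E3_def by (simp_all add: integral_distr)
  have nonneg: "0 \<le> E1" "0 \<le> E3" "0 \<le> B1" "0 \<le> B3"
    unfolding E1_def E3_def B1_def B3_def by simp_all
  define x where "x = sqrt (real CARD('n))"
  have x: "0 < x" "x\<^sup>2 = real CARD('n)"
    by (simp_all add: x_def)
  have B1: "B1 \<le> x" and E3: "x ^ 3 \<le> E3"
    using N.first_moment_le \<mu>.third_moment_ge unfolding B1_def x_def law_moments by simp_all
  have "B3 \<le> (real CARD('n) + 1) * B1"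
    unfolding B1_def B3_def by (rule std_gaussian_third_moment_le)
  also have "\<dots> \<le> (x\<^sup>2 + 1) * x"
    unfolding x(2) using B1 by (intro mult_left_mono) auto
  finally have B3: "B3 \<le> x ^ 3 + x"
    by (simp add: power2_eq_square power3_eq_cube algebra_simps)
  let ?l = "1 + ln (real n)"
  have l: "1 \<le> ?l" "harm m \<le> ?l"
    using n harm_le_one_plus_ln [of m] by simp_all
  let ?C = "(2 / 3 * real CARD('n) + 1) * \<beta> + 1 / 3 * E3 + E1"
  have C: "1 / 6 * (B3 + E3) + (B1 + E1) \<le> ?C"
  proof -
    \<comment> \<open>Half of this square gives \<open>7 / 6 * x \<le> x^2 / 2 + 49 / 72\<close>,
      and 49/72 is below 3/4.\<close>
    have "0 \<le> (x - 7 / 6)\<^sup>2"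
      by simp
    then have "7 / 6 * x \<le> (2 / 3 * x\<^sup>2 + 1) * (3 / 4)"
      by (simp add: power2_eq_square algebra_simps)
    also have "\<dots> \<le> (2 / 3 * x\<^sup>2 + 1) * \<beta>"
      using \<beta> by (intro mult_left_mono) auto
    finally have "7 / 6 * x \<le> (2 / 3 * real CARD('n) + 1) * \<beta>"
      by (simp only: x(2))
    \<comment> \<open>The cubic part of the Gaussian third moment is charged to \<open>E3\<close>,
      raising its coefficient from 1/6 to 1/3. What remains is \<open>x / 6\<close>, and
      \<open>B1\<close> adds at most \<open>x\<close>: together 7/6.\<close>
    moreover have "B3 \<le> E3 + x"
      using order_trans [OF B3 add_right_mono [OF E3]] .
    then have "1 / 6 * (B3 + E3) + (B1 + E1) \<le> 7 / 6 * x + 1 / 3 * E3 + E1"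
      using B1 by (simp add: field_simps)
    ultimately show ?thesis
      by simp
  qed
  \<comment> \<open>Since \<open>?l\<close> is at least 1, the cost of the last exchange may also be
    multiplied by it, which gives the product form of the bound.\<close>
  have "harm m / 6 * (B3 + E3) + (B1 + E1) \<le> ?l / 6 * (B3 + E3) + ?l * (B1 + E1)"
    using l nonneg mult_right_mono [of 1 ?l "B1 + E1"] by (intro add_mono mult_right_mono) auto
  also have "\<dots> = (1 / 6 * (B3 + E3) + (B1 + E1)) * ?l"
    by (simp add: algebra_simps)
  also have "\<dots> \<le> ?C * ?l"
    using l C by (intro mult_right_mono) auto
  finally have const: "1 / sqrt (real n) * (harm m / 6 * (B3 + E3) + (B1 + E1)) \<le> ?C * (1 / sqrt (real n)) * ?l"
    using mult_left_mono [of _ "?C * ?l" "1 / sqrt (real n)"] by (simp only: mult_ac) simp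
  show ?thesis
    unfolding wasserstein_dist_def E1_def [symmetric] E3_def [symmetric]
  proof (rule SUP_least)
    fix h :: "real^'n \<Rightarrow> real"
    assume "h \<in> {h. \<forall>x y. \<bar>h x - h y\<bar> \<le> dist x y}"
    then have lip: "\<bar>h x - h y\<bar> \<le> dist x y" for x y
      by simp
    have [measurable]: "h \<in> borel_measurable borel"
      by (rule lipschitz_borel_measurable [where K = 1]) (simp add: lip)
    let ?S = "\<lambda>\<omega>. (1 / sqrt (real n)) *\<^sub>R (\<Sum>i\<in>{1..n}. \<xi> i \<omega>)"
    have "\<bar>(\<integral>x. h x \<partial>std_gaussian) - (\<integral>x. h x \<partial>distr M borel ?S)\<bar>
        = \<bar>(\<integral>x. h x \<partial>std_gaussian) - expectation (\<lambda>\<omega>. h (?S \<omega>))\<bar>"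
      by (subst integral_distr) simp_all
    also have "\<dots> \<le> 1 / sqrt (real n) * (harm m / 6 * (B3 + E3) + (B1 + E1))"
      using lindeberg_lipschitz_bound [OF indep law \<mu>.isotropic_law_axioms lip, of m]
      unfolding law_moments n [symmetric] B1_def [symmetric] B3_def [symmetric] .
    also note const
    finally show "ennreal \<bar>(\<integral>x. h x \<partial>std_gaussian) - (\<integral>x. h x \<partial>distr M borel ?S)\<bar>
        \<le> ennreal (?C * (1 / sqrt (real n)) * ?l)"
      by (rule ennreal_leI)
  qed
qed

theorem theorem3p3:
  fixes M :: "'a measure" and \<xi> :: "nat \<Rightarrow> 'a \<Rightarrow> real ^ 'n" and n :: nat
  assumes "prob_space M"
    and meas: "\<And>i. \<xi> i \<in> borel_measurable M"
    and indep: "prob_space.indep_vars M (\<lambda>_. borel) \<xi> UNIV"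
    and ident: "\<And>i. distr M borel (\<xi> i) = distr M borel (\<xi> 0)"
    and mean: "\<And>i. integrable M (\<xi> i) \<and> (\<integral>\<omega>. \<xi> i \<omega> \<partial>M) = 0"
    and cov: "\<And>i j k. integrable M (\<lambda>\<omega>. \<xi> i \<omega> $ j * \<xi> i \<omega> $ k) \<and>
                (\<integral>\<omega>. \<xi> i \<omega> $ j * \<xi> i \<omega> $ k \<partial>M) = (if j = k then 1 else 0)"
    and third: "(SUP i. \<integral>\<^sup>+ \<omega>. ennreal (norm (\<xi> i \<omega>) ^ 3) \<partial>M) < \<infinity>"
    and "n \<ge> 1"
  shows "wasserstein_dist std_gaussian
           (distr M borel (\<lambda>\<omega>. (1 / sqrt (real n)) *\<^sub>R (\<Sum>i\<in>{1..n}. \<xi> i \<omega>)))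
         \<le> ennreal (((2 / 3 * real CARD('n) + 1) * (\<integral>x. norm x \<partial>std_gaussian)
                      + 1 / 3 * (\<integral>\<omega>. norm (\<xi> 1 \<omega>) ^ 3 \<partial>M)
                      + (\<integral>\<omega>. norm (\<xi> 1 \<omega>) \<partial>M))
                     * (1 / sqrt (real n)) * (1 + ln (real n)))"
\<comment> \<open>\<open>\<beta>\<close> becomes the mean norm of a standard Gaussian, which
  \<open>std_gaussian_norm_ge\<close> bounds below in any dimension.\<close>
proof (rule wasserstein_dist_clt [OF assms(1) meas indep ident _ _ _ _ \<open>n \<ge> 1\<close> std_gaussian_norm_ge])
  show "(\<integral>\<^sup>+ \<omega>. ennreal (norm (\<xi> 1 \<omega>) ^ 3) \<partial>M) < \<infinity>"
    by (rule le_less_trans [OF _ third]) (rule SUP_upper, simp)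
qed (use mean cov in auto)

end
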